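(* For every integer $k\geq1$ there is a two-variable polynomial $R_k(p,y)$ (depending only on $k$), with degree in $y$ $$\deg_y R_k(p,y)=\left\lfloor\frac{k-1}{2}\right\rfloor,$$ such that for every real $p>-1$ and every integer $n\geq1$ $$\alpha_k=\frac{R_k\left(p,\,j_{p,n}^{2}\right)}{2^k\, k!\,\left(j_{p,n}^{2}\right)^k}.$$ Consequently, for every integer $r\geq3$ there is a two-variable polynomial $P_r(p,y)$ (depending only on $r$), with $$\deg_y P_r(p,y)=\left\lfloor\frac{r-2}{2}\right\rfloor,$$ such that for every real $p>-1$ and every integer $n\geq1$ $$\mathcal{S}_r(p,n)=\frac{P_r\left(p,\,j_{p,n}^{2}\right)}{2^r\,(r-1)!\,\left(j_{p,n}^{2}\right)^{r-3}};$$ equivalently, the degree in $z$ of the numerator polynomial $P_r(p,z^2)$ (with $z$ standing for $j_{p,n}$) is $2\lfloor\frac{r-2}{2}\rfloor$, that is, $r-2$ if $r$ is even and $r-3$ if $r$ is odd.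
   Context: For real $\nu>-1$, $J_\nu$ is the Bessel function of the first kind of order $\nu$ and $j_{\nu,m}$ denotes its $m$th positive zero ($m\ge1$). For $p>-1$ and integers $n\ge1$, $r\geq 2$, $$\mathcal{S}_r(p,n)=\sum_{m\geq1}\frac{j_{p,n}^2\,j_{p+1,m}^2}{(j_{p+1,m}^2-j_{p,n}^2)^r}.$$ The function $A_p(x)=\dfrac{J_p(\sqrt{x})}{\sqrt{x}\,J_{p+1}(\sqrt{x})}$ is analytic near $x=j_{p,n}^2$ (since $J_p$ and $J_{p+1}$ have no common positive zeros), and $\alpha_k=\alpha_k(p,n)=A_p^{(k)}(j_{p,n}^2)/k!$ denotes its $k$th Taylor coefficient at $j_{p,n}^2$. Degrees in $y$ are degrees of polynomials in the two indeterminates $p,y$, regarded as polynomials in $y$ with coefficients that are polynomials in $p$. *)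

theory Defs
  imports "HOL-Analysis.Analysis" "HOL-Computational_Algebra.Polynomial"
begin

text \<open>
  Bessel function of the first kind for real order \<open>\<nu> > -1\<close>. Because of \<open>powr\<close>,
  the definition is meaningful for arguments \<open>x > 0\<close> only.
\<close>

definition bessel_J :: "real \<Rightarrow> real \<Rightarrow> real" where
  "bessel_J \<nu> x =
     (\<Sum>i. (- 1) ^ i / (fact i * Gamma (real i + \<nu> + 1)) * (x / 2) powr (2 * real i + \<nu>))"

text \<open>
  The \<open>m\<close>-th positive zero, counting from \<open>m = 1\<close>: the positive zero \<open>x\<close> for which there
  are exactly \<open>m\<close> zeros in \<open>(0, x]\<close>. All positive zeros are simple, so multiplicities play no role.
\<close>

definition bessel_zero :: "real \<Rightarrow> nat \<Rightarrow> real" where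
  "bessel_zero \<nu> m =
     (THE x. x > 0 \<and> bessel_J \<nu> x = 0 \<and> card {t. 0 < t \<and> t \<le> x \<and> bessel_J \<nu> t = 0} = m)"

definition bessel_sum_term :: "nat \<Rightarrow> real \<Rightarrow> nat \<Rightarrow> nat \<Rightarrow> real" where
  "bessel_sum_term r p n m =
     (bessel_zero p n)\<^sup>2 * (bessel_zero (p + 1) m)\<^sup>2 /
     ((bessel_zero (p + 1) m)\<^sup>2 - (bessel_zero p n)\<^sup>2) ^ r"

definition bessel_sum :: "nat \<Rightarrow> real \<Rightarrow> nat \<Rightarrow> real" where
  "bessel_sum r p n = (\<Sum>m. bessel_sum_term r p n (Suc m))"

definition bessel_quot :: "real \<Rightarrow> real \<Rightarrow> real" where
  "bessel_quot p x = bessel_J p (sqrt x) / (sqrt x * bessel_J (p + 1) (sqrt x))"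

definition bessel_alpha :: "nat \<Rightarrow> real \<Rightarrow> nat \<Rightarrow> real" where
  "bessel_alpha k p n = (deriv ^^ k) (bessel_quot p) ((bessel_zero p n)\<^sup>2) / fact k"

text \<open>
  A polynomial in \<open>p\<close> and \<open>y\<close> is an element of \<open>real poly poly\<close>: the outer indeterminate
  is \<open>y\<close>, the coefficients are polynomials in \<open>p\<close>; thus \<open>degree\<close> is the degree in \<open>y\<close>.
\<close>

definition poly2 :: "real poly poly \<Rightarrow> real \<Rightarrow> real \<Rightarrow> real" where
  "poly2 R p y = poly (map_poly (\<lambda>c. poly c p) R) y"

end

theory Submission
  imports Defs "HOL-Real_Asymp.Real_Asymp"
begin

text \<open>
  Write \<open>F\<^sub>\<nu>(t) = \<Sum>i. (-t/4)\<^sup>i / (i! \<Gamma>(i + \<nu> + 1))\<close>, so that \<open>J\<^sub>\<nu>(x) = (x/2)\<^sup>\<nu> F\<^sub>\<nu>(x\<^sup>2)\<close> and the quotient of the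
  paper is \<open>A = 2 F\<^sub>p / (x F\<^bsub>p+1\<^esub>)\<close>. The contiguity relations turn into the Riccati equation
  \<open>2 x A' = -1 - x A\<^sup>2 + 2 p A\<close>; differentiating it \<open>k\<close> times at a zero of \<open>A\<close> gives the recursion that
  defines the polynomials \<open>R\<^sub>k\<close>. Their leading coefficients in \<open>y\<close> are all negative for the order of
  real polynomials by leading coefficient, since every term of the recursion contributes with the
  same sign.

  For the sums, \<open>A = 2(p + 1)/x + 2 F'/F\<close> with \<open>F = F\<^bsub>p+1\<^esub>\<close>, and it suffices to know the partial fraction
  expansion \<open>-(F'/F)' = \<Sum> 1/(a - x)\<^sup>2\<close> over the positive zeros \<open>a\<close> of \<open>F\<close>. This is the limit of the same
  identity for the Laguerre polynomials, rescaled so as to converge to \<open>F\<close>. They have simple positive roots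
  by Rolle's theorem, and the constant sum of the reciprocals of these roots controls the tails. Working
  with the second power avoids Hadamard factorisation.
\<close>

section \<open>The entire function of the Bessel series\<close>

text \<open>The degree is exact only if leading terms cannot cancel. With d(i) = (i - 1) div 2, a
  product R_i R_j with i, j \<ge> 1 and i + j \<le> m has degree at most m div 2 - 1 in y, so the
  factor y of the recursion brings it to at most d(m + 1). That degree is reached by the linear term
  2(p - m) R_m for odd m and by R_1 R_{m-1} for even m. The factor p - m takes both signs on p > -1,
  so signs cannot be compared at a fixed p; as a polynomial in p it is positive.

  In a y/(a - y)^r = y/(a - y)^{r-1} + y^2/(a - y)^r the two sums on the right are Taylor
  coefficients of A up to contributions of the pole 2(p + 1)/x, and these cancel. So P_r combines
  R_{r-2} and R_{r-1} with factors of equal sign, and again nothing cancels. For r \<ge> 3 both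
  exponents are at least 2.

  The Laguerre polynomial of degree N at t/(4N) has, up to a constant, the Bessel coefficients times
  N(N - 1)...(N - i + 1)/N^i. These factors lie in [0, 1] and tend to 1, so the Bessel series itself
  dominates the convergence (Mehler-Heine).\<close>

definition bessel_coeff :: "real \<Rightarrow> nat \<Rightarrow> real" where
  "bessel_coeff \<nu> i = (- 1) ^ i / (fact i * Gamma (real i + \<nu> + 1) * 4 ^ i)"

definition bessel_F :: "real \<Rightarrow> real \<Rightarrow> real" where
  "bessel_F \<nu> t = (\<Sum>i. bessel_coeff \<nu> i * t ^ i)"

lemma Gamma_shift:
  fixes \<nu> :: real
  assumes "\<nu> > -1"
  shows "Gamma (real i + \<nu> + 2) = (real i + \<nu> + 1) * Gamma (real i + \<nu> + 1)"
proof -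
  have "real i + \<nu> + 1 > 0" using assms by linarith
  then have "real i + \<nu> + 1 \<notin> \<int>\<^sub>\<le>\<^sub>0"
    by (metis nonpos_Ints_nonpos not_le)
  from Gamma_plus1[OF this] show ?thesis by (simp add: add.assoc)
qed

lemma Gamma_shift_lower_bound:
  fixes \<nu> :: real
  assumes "\<nu> > -1"
  shows "\<exists>c>0. \<forall>i. c \<le> Gamma (real i + \<nu> + 1)"
proof -
  \<comment> \<open>The first factor \<open>\<nu> + 1\<close> may be below 1, hence the minimum of
    the first two values; all later factors exceed 1.\<close>
  define c where "c = min (Gamma (\<nu> + 1)) (Gamma (\<nu> + 2))"
  have "c > 0" using assms by (simp add: c_def Gamma_real_pos)
  moreover have "c \<le> Gamma (real (Suc i) + \<nu> + 1)" for i
  proof (induction i)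
    case 0
    show ?case by (simp add: c_def add.commute)
  next
    case (Suc i)
    have pos: "Gamma (real (Suc i) + \<nu> + 1) > 0" using assms by (intro Gamma_real_pos) auto
    have eq: "Gamma (real (Suc (Suc i)) + \<nu> + 1) = (real (Suc i) + \<nu> + 1) * Gamma (real (Suc i) + \<nu> + 1)"
      using Gamma_shift[OF assms, of "Suc i"] by (simp add: algebra_simps)
    have "1 * Gamma (real (Suc i) + \<nu> + 1) \<le> (real (Suc i) + \<nu> + 1) * Gamma (real (Suc i) + \<nu> + 1)"
      using pos assms by (intro mult_right_mono) auto
    with Suc eq show ?case by linarith
  qed
  moreover have "c \<le> Gamma (real 0 + \<nu> + 1)" by (simp add: c_def)
  ultimately show ?thesis
    by (metis not0_implies_Suc)
qed

text \<open>Gamma is bounded below at these arguments, so the exponential series dominates. The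
  absolute form serves later as a majorant on whole intervals.\<close>

lemma bessel_coeff_summable:
  assumes "\<nu> > -1"
  shows "summable (\<lambda>i. \<bar>bessel_coeff \<nu> i\<bar> * T ^ i)"
proof -
  obtain c where c: "c > 0" "\<And>i. c \<le> Gamma (real i + \<nu> + 1)"
    using Gamma_shift_lower_bound[OF assms] by blast
  have "summable (\<lambda>i. 1 / c * (\<bar>T\<bar> ^ i /\<^sub>R fact i))"
    by (intro summable_mult sums_summable[OF exp_converges])
  moreover have "norm (\<bar>bessel_coeff \<nu> i\<bar> * T ^ i) \<le> 1 / c * (\<bar>T\<bar> ^ i /\<^sub>R fact i)" for i
  proof -
    have "c * fact i * 1 \<le> Gamma (real i + \<nu> + 1) * fact i * 4 ^ i"
      using c less_le_trans[OF c(1) c(2)[of i]] by (intro mult_mono) auto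
    then have "1 / (Gamma (real i + \<nu> + 1) * fact i * 4 ^ i) \<le> 1 / (c * fact i * 1)"
      using c(1) by (intro divide_left_mono) (auto intro!: mult_pos_pos intro: less_le_trans[OF c(1) c(2)])
    moreover have "\<bar>bessel_coeff \<nu> i\<bar> = 1 / (Gamma (real i + \<nu> + 1) * fact i * 4 ^ i)"
      using less_le_trans[OF c(1) c(2)[of i]] by (simp add: bessel_coeff_def abs_mult power_abs)
    ultimately have "\<bar>bessel_coeff \<nu> i\<bar> * \<bar>T\<bar> ^ i \<le> 1 / (c * fact i * 1) * \<bar>T\<bar> ^ i"
      by (intro mult_right_mono) auto
    then show ?thesis by (simp add: abs_mult power_abs field_simps)
  qed
  ultimately show ?thesis by (rule summable_comparison_test'[of _ 0])
qed

lemma bessel_F_summable: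
  assumes "\<nu> > -1"
  shows "summable (\<lambda>i. bessel_coeff \<nu> i * t ^ i)"
  using bessel_coeff_summable[OF assms, of "\<bar>t\<bar>"]
  by (intro summable_norm_cancel[of "\<lambda>i. bessel_coeff \<nu> i * t ^ i"]) (simp add: abs_mult power_abs)

lemma diffs_bessel_coeff: "diffs (bessel_coeff \<nu>) i = -(1/4) * bessel_coeff (\<nu> + 1) i"
proof -
  have "diffs (bessel_coeff \<nu>) i =
      real (Suc i) * ((- 1) ^ Suc i / (real (Suc i) * fact i * Gamma (real i + (\<nu> + 1) + 1) * 4 ^ Suc i))"
    unfolding diffs_def bessel_coeff_def fact_Suc by (simp only: of_nat_Suc of_nat_fact add_ac of_nat_mult)
  also have "\<dots> = -(1/4) * bessel_coeff (\<nu> + 1) i"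
    unfolding bessel_coeff_def by (simp del: of_nat_Suc)
  finally show ?thesis .
qed

lemma bessel_F_deriv:
  assumes "\<nu> > -1"
  shows "(bessel_F \<nu> has_real_derivative - bessel_F (\<nu> + 1) t / 4) (at t)"
proof -
  have "(\<Sum>i. diffs (bessel_coeff \<nu>) i * t ^ i) = (\<Sum>i. -(1/4) * (bessel_coeff (\<nu> + 1) i * t ^ i))"
    by (simp add: diffs_bessel_coeff mult.assoc)
  also have "\<dots> = - bessel_F (\<nu> + 1) t / 4"
    unfolding bessel_F_def using bessel_F_summable[of "\<nu> + 1" t] assms by (subst suminf_mult) auto
  finally show ?thesis
    using termdiffs_strong_converges_everywhere[OF bessel_F_summable[OF assms], of t]
    by (simp add: bessel_F_def[abs_def])
qed

lemma bessel_F_deriv' [derivative_intros]: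
  assumes "(f has_real_derivative f') (at x within S)" "\<nu> > -1"
  shows "((\<lambda>x. bessel_F \<nu> (f x)) has_real_derivative - bessel_F (\<nu> + 1) (f x) / 4 * f') (at x within S)"
  using DERIV_chain2[OF bessel_F_deriv[OF assms(2)] assms(1)] .

text \<open>This is J_\<nu> + J_{\<nu>+2} = (2(\<nu>+1)/x) J_{\<nu>+1}, compared coefficient by
  coefficient. With F' = -F_{\<nu>+1}/4 it encodes Bessel's equation as t F'' + (\<nu>+1) F' + F/4 =
  0.\<close>

lemma bessel_F_recurrence:
  assumes "\<nu> > -1"
  shows "bessel_F \<nu> t = (\<nu> + 1) * bessel_F (\<nu> + 1) t - t / 4 * bessel_F (\<nu> + 2) t"
proof -
  have pos: "real i + \<nu> + 1 > 0" "Gamma (real i + \<nu> + 1) > 0" for i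
  proof -
    show "real i + \<nu> + 1 > 0" using assms by linarith
    then show "Gamma (real i + \<nu> + 1) > 0" by (rule Gamma_real_pos)
  qed
  have cf: "bessel_coeff \<nu> (Suc i) = (\<nu> + 1) * bessel_coeff (\<nu> + 1) (Suc i) - bessel_coeff (\<nu> + 2) i / 4" for i
  proof -
    define g where "g = Gamma (real i + \<nu> + 2)"
    define s :: real where "s = (- 1) ^ i / (fact i * 4 ^ i)"
    have g: "g > 0" "Gamma (real i + \<nu> + 3) = (real i + \<nu> + 2) * g"
      using pos(2)[of "Suc i"] Gamma_shift[OF assms, of "Suc i"] by (simp_all add: g_def algebra_simps)
    have i2: "real i + \<nu> + 2 > 0" using pos(1)[of i] by linarith
    have "bessel_coeff \<nu> (Suc i) = - s / (4 * (real i + 1) * g)"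
      by (simp add: bessel_coeff_def s_def g_def add_ac mult_ac)
    moreover have "bessel_coeff (\<nu> + 1) (Suc i) = - s / (4 * (real i + 1) * ((real i + \<nu> + 2) * g))"
      unfolding g(2)[symmetric] by (simp add: bessel_coeff_def s_def add_ac mult_ac)
    moreover have "bessel_coeff (\<nu> + 2) i = s / ((real i + \<nu> + 2) * g)"
      unfolding g(2)[symmetric] by (simp add: bessel_coeff_def s_def add_ac mult_ac)
    moreover have "- s / (4 * (real i + 1) * g) =
      (\<nu> + 1) * (- s / (4 * (real i + 1) * ((real i + \<nu> + 2) * g))) - s / ((real i + \<nu> + 2) * g) / 4"
    proof -
      have "real i + 1 \<noteq> 0" by linarith
      then have "(\<nu> + 1) * (- s / (4 * (real i + 1) * ((real i + \<nu> + 2) * g))) - s / ((real i + \<nu> + 2) * g) / 4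
        = - s * ((\<nu> + 1) + (real i + 1)) / (4 * (real i + 1) * ((real i + \<nu> + 2) * g))"
        using g(1) i2 by (simp add: divide_simps) (simp add: algebra_simps)
      also have "\<dots> = - s * (real i + \<nu> + 2) / (4 * (real i + 1) * g * (real i + \<nu> + 2))"
        by (simp add: algebra_simps)
      finally show ?thesis using i2 by simp
    qed
    ultimately show ?thesis by simp
  qed
  have c0: "bessel_coeff \<nu> 0 = (\<nu> + 1) * bessel_coeff (\<nu> + 1) 0"
    using Gamma_shift[OF assms, of 0] pos[of 0] by (simp add: bessel_coeff_def add_ac)
  have s: "summable (\<lambda>i. bessel_coeff \<nu> i * t ^ i)" "summable (\<lambda>i. bessel_coeff (\<nu> + 1) i * t ^ i)"
    "summable (\<lambda>i. bessel_coeff (\<nu> + 2) i * t ^ i)"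
    using assms by (auto intro!: bessel_F_summable)
  have s1: "summable (\<lambda>i. bessel_coeff (\<nu> + 1) (Suc i) * t ^ Suc i)"
    using s(2) by (subst summable_Suc_iff)
  have "bessel_F \<nu> t = bessel_coeff \<nu> 0 + (\<Sum>i. bessel_coeff \<nu> (Suc i) * t ^ Suc i)"
    using suminf_split_head[OF s(1)] by (simp add: bessel_F_def)
  also have "(\<Sum>i. bessel_coeff \<nu> (Suc i) * t ^ Suc i) =
     (\<Sum>i. (\<nu> + 1) * (bessel_coeff (\<nu> + 1) (Suc i) * t ^ Suc i) - t / 4 * (bessel_coeff (\<nu> + 2) i * t ^ i))"
    by (simp add: cf algebra_simps)
  also have "\<dots> = (\<nu> + 1) * (\<Sum>i. bessel_coeff (\<nu> + 1) (Suc i) * t ^ Suc i) - t / 4 * bessel_F (\<nu> + 2) t"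
    unfolding bessel_F_def using s s1
    by (simp only: suminf_diff[OF summable_mult summable_mult, symmetric] suminf_mult[symmetric])
  also have "bessel_coeff \<nu> 0 + \<dots> = (\<nu> + 1) * bessel_F (\<nu> + 1) t - t / 4 * bessel_F (\<nu> + 2) t"
    using suminf_split_head[OF s(2)] by (simp add: bessel_F_def c0 right_diff_distrib)
  finally show ?thesis .
qed

lemma bessel_F_0: "bessel_F \<nu> 0 = 1 / Gamma (\<nu> + 1)"
  unfolding bessel_F_def powser_zero by (simp add: bessel_coeff_def)

lemma bessel_F_0_pos: "\<nu> > -1 \<Longrightarrow> bessel_F \<nu> 0 > 0"
  unfolding bessel_F_0 by (intro divide_pos_pos Gamma_real_pos) auto

lemma continuous_on_bessel_F: "\<nu> > -1 \<Longrightarrow> continuous_on S (bessel_F \<nu>)"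
  by (intro continuous_at_imp_continuous_on ballI DERIV_isCont[OF bessel_F_deriv])

text \<open>
  With \<open>F = bessel_F \<nu>\<close>, the energy \<open>F\<^sup>2/4 + t F'\<^sup>2\<close> has derivative \<open>-(2\<nu> + 1) F'\<^sup>2\<close>; hence
  multiplying it by \<open>t powr \<bar>2\<nu> + 1\<bar>\<close> makes it nondecreasing, and a double zero would force
  \<open>F\<close> to vanish on the whole interval to the left of it.
\<close>
lemma bessel_F_zeros_simple:
  assumes \<nu>: "\<nu> > -1" and "x > 0" and zero: "bessel_F \<nu> x = 0"
  shows "bessel_F (\<nu> + 1) x \<noteq> 0"
proof
  assume zero': "bessel_F (\<nu> + 1) x = 0"
  define c where "c = \<bar>2 * \<nu> + 1\<bar>"
  \<comment> \<open>Sixteen times the weighted energy, because F' = -F_{\<nu>+1}/4.\<close>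
  define E where "E = (\<lambda>t. t powr c * (4 * bessel_F \<nu> t ^ 2 + t * bessel_F (\<nu> + 1) t ^ 2))"
  have F0: "bessel_F \<nu> t = 0" if t: "0 < t" "t \<le> x" for t
  proof -
    have "E t \<le> E x"
    proof (rule DERIV_nonneg_imp_nondecreasing[OF t(2)])
      fix s assume s: "t \<le> s" "s \<le> x"
      with t have "s > 0" by simp
      define a b where "a = bessel_F \<nu> s" and "b = bessel_F (\<nu> + 1) s"
      have b2: "s * bessel_F (\<nu> + 2) s = 4 * ((\<nu> + 1) * b - a)"
        using bessel_F_recurrence[OF \<nu>, of s] by (simp add: a_def b_def)
      have "(E has_real_derivative (c * s powr (c - 1) * (4 * a\<^sup>2 + s * b\<^sup>2) +
          s powr c * (b\<^sup>2 - 2 * a * b - b / 2 * (s * bessel_F (\<nu> + 2) s)))) (at s)"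
        unfolding E_def using \<nu> \<open>s > 0\<close>
        by (auto intro!: derivative_eq_intros simp: a_def b_def)
           (simp add: algebra_simps power2_eq_square)
      moreover have "c * s powr (c - 1) * (4 * a\<^sup>2 + s * b\<^sup>2) +
          s powr c * (b\<^sup>2 - 2 * a * b - b / 2 * (s * bessel_F (\<nu> + 2) s))
        = s powr (c - 1) * (4 * c * a\<^sup>2 + s * b\<^sup>2 * (c - (2 * \<nu> + 1)))"
      proof -
        have "s powr c = s * s powr (c - 1)" using \<open>s > 0\<close> by (simp add: powr_diff)
        then show ?thesis unfolding b2 by (simp add: algebra_simps power2_eq_square)
      qed
      moreover have "\<dots> \<ge> 0"
        using \<open>s > 0\<close> by (intro mult_nonneg_nonneg add_nonneg_nonneg) (auto simp: c_def)
      ultimately show "\<exists>y. (E has_real_derivative y) (at s) \<and> 0 \<le> y" by auto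
    qed
    also have "E x = 0" by (simp add: E_def zero zero')
    finally have "4 * bessel_F \<nu> t ^ 2 + t * bessel_F (\<nu> + 1) t ^ 2 \<le> 0"
      using t by (simp add: E_def mult_le_0_iff)
    moreover have "t * bessel_F (\<nu> + 1) t ^ 2 \<ge> 0" using t by simp
    ultimately have "bessel_F \<nu> t ^ 2 \<le> 0" by linarith
    then show ?thesis by simp
  qed
  have "(bessel_F \<nu> \<longlongrightarrow> bessel_F \<nu> 0) (at_right 0)"
    using DERIV_isCont[OF bessel_F_deriv[OF \<nu>]] by (simp add: isCont_def filterlim_at_split)
  moreover have "eventually (\<lambda>t. bessel_F \<nu> t = 0) (at_right 0)"
    unfolding eventually_at_right_field using F0 \<open>x > 0\<close> by (intro exI[of _ x]) auto
  ultimately have "((\<lambda>_. 0) \<longlongrightarrow> bessel_F \<nu> 0) (at_right (0::real))"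
    by (rule Lim_transform_eventually)
  then show False using bessel_F_0_pos[OF \<nu>] by (simp add: tendsto_const_iff)
qed

section \<open>Zeros of the Bessel function and of its series\<close>

lemma bessel_J_eq:
  assumes "\<nu> > -1" "x > 0"
  shows "bessel_J \<nu> x = (x / 2) powr \<nu> * bessel_F \<nu> (x\<^sup>2)"
proof -
  have "(- 1) ^ i / (fact i * Gamma (real i + \<nu> + 1)) * (x / 2) powr (2 * real i + \<nu>) =
     (x / 2) powr \<nu> * (bessel_coeff \<nu> i * (x\<^sup>2) ^ i)" for i
  proof -
    have "(x / 2) powr (2 * real i) = (x / 2) ^ (2 * i)"
      using assms by (metis half_gt_zero of_nat_mult of_nat_numeral powr_realpow)
    also have "\<dots> = (x\<^sup>2) ^ i / 4 ^ i" by (simp add: power_mult power_divide)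
    finally show ?thesis by (simp add: powr_add bessel_coeff_def)
  qed
  then show ?thesis
    unfolding bessel_J_def bessel_F_def
    by (simp add: suminf_mult bessel_F_summable[OF assms(1)])
qed

text \<open>These are the squares of the positive zeros of J_\<nu>, as the series is taken in the
  variable t = x^2.\<close>

definition bessel_Z :: "real \<Rightarrow> real set" where
  "bessel_Z \<nu> = {a. a > 0 \<and> bessel_F \<nu> a = 0}"

text \<open>An accumulation point would be a zero by continuity, and positive because F(0) > 0,
  hence simple. But the difference quotients there tend to a nonzero derivative and cannot vanish at
  nearby points.\<close>

lemma finite_bessel_Z:
  assumes \<nu>: "\<nu> > -1"
  shows "finite {a \<in> bessel_Z \<nu>. a \<le> X}"
proof (rule ccontr)
  assume inf: "infinite {a \<in> bessel_Z \<nu>. a \<le> X}"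
  let ?S = "{a \<in> bessel_Z \<nu>. a \<le> X}"
  have "?S \<subseteq> {0..X}" by (auto simp: bessel_Z_def)
  with inf obtain l where l: "l \<in> {0..X}" "l islimpt ?S"
    using compact_eq_Bolzano_Weierstrass[of "{0..X}"] by auto
  have "closed {a. bessel_F \<nu> a = 0}"
    using continuous_on_bessel_F[OF \<nu>, of UNIV] by (simp add: closed_Collect_eq)
  moreover have "l islimpt {a. bessel_F \<nu> a = 0}"
    using l(2) by (rule islimpt_subset) (auto simp: bessel_Z_def)
  ultimately have Fl: "bessel_F \<nu> l = 0" by (auto simp: closed_limpt)
  then have "l \<noteq> 0" using bessel_F_0_pos[OF \<nu>] by force
  with l have "l > 0" by auto
  then have "bessel_F (\<nu> + 1) l \<noteq> 0" using bessel_F_zeros_simple[OF \<nu> _ Fl] by auto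
  then have "- bessel_F (\<nu> + 1) l / 4 \<noteq> 0" by simp
  moreover have "((\<lambda>t. (bessel_F \<nu> t - bessel_F \<nu> l) / (t - l)) \<longlongrightarrow> - bessel_F (\<nu> + 1) l / 4) (at l)"
    using bessel_F_deriv[OF \<nu>, of l] by (simp add: has_field_derivative_iff)
  ultimately have "eventually (\<lambda>t. (bessel_F \<nu> t - bessel_F \<nu> l) / (t - l) \<noteq> 0) (at l)"
    by (intro tendsto_imp_eventually_ne)
  then have "eventually (\<lambda>t. t \<notin> ?S) (at l)"
    by eventually_elim (auto simp: bessel_Z_def Fl)
  with l(2) show False by (simp add: islimpt_iff_eventually)
qed

section \<open>Roots of Laguerre polynomials\<close>

text \<open>The monic multiple \<open>(-1)\<^sup>n n! L\<^sub>n\<close> of the Laguerre polynomial \<open>L\<^sub>n\<close> with parameter \<open>\<alpha>\<close>.\<close>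
primrec laguerre_monic :: "real \<Rightarrow> nat \<Rightarrow> real poly" where
  "laguerre_monic \<alpha> 0 = 1"
| "laguerre_monic \<alpha> (Suc n) =
     [:- (real n + \<alpha> + 1), 1:] * laguerre_monic \<alpha> n - [:0, 1:] * pderiv (laguerre_monic \<alpha> n)"

text \<open>The recursion gives access to the roots; this closed form links the polynomials to the
  Bessel coefficients.\<close>

lemma coeff_laguerre_monic:
  assumes "\<alpha> > -1"
  shows "coeff (laguerre_monic \<alpha> n) i =
    (- 1) ^ (n + i) * real (n choose i) * Gamma (real n + \<alpha> + 1) / Gamma (real i + \<alpha> + 1)"
proof (induction n arbitrary: i)
  have pos: "Gamma (real i + \<alpha> + 1) > 0" for i
    using assms by (intro Gamma_real_pos) linarith
  {
    case 0
    show ?case using pos[of 0] by (cases i) auto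
  next
    case (Suc n)
    define c where "c = coeff (laguerre_monic \<alpha> n)"
    define g where "g = Gamma (real n + \<alpha> + 1)"
    have G: "Gamma (real (Suc n) + \<alpha> + 1) = (real n + \<alpha> + 1) * g"
      using Gamma_shift[OF assms, of n] by (simp add: g_def algebra_simps)
    show ?case
    proof (cases i)
      case 0
      define d where "d = real n + \<alpha> + 1"
      have "coeff (laguerre_monic \<alpha> (Suc n)) i = - d * coeff (laguerre_monic \<alpha> n) 0"
        by (simp add: d_def 0)
      then have "coeff (laguerre_monic \<alpha> (Suc n)) i =
          - d * ((- 1) ^ (n + 0) * real (n choose 0) * g / Gamma (real 0 + \<alpha> + 1))"
        unfolding Suc.IH g_def .
      then show ?thesis
        unfolding G 0 d_def[symmetric] by (simp del: laguerre_monic.simps)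
    next
      case (Suc j)
      define h where "h = Gamma (real j + \<alpha> + 1)"
      have h: "h > 0" "Gamma (real (Suc j) + \<alpha> + 1) = (real j + \<alpha> + 1) * h"
        using pos[of j] Gamma_shift[OF assms, of j] by (simp_all add: h_def algebra_simps)
      have j1: "real j + \<alpha> + 1 > 0" using assms by linarith
      \<comment> \<open>With this, C(n, j) collects the factor (j + \<alpha> + 1) + (n - j) = n +
        \<alpha> + 1, the same as C(n, j + 1), and Pascal's rule applies.\<close>
      have absorb: "(real j + 1) * real (n choose Suc j) = (real n - real j) * real (n choose j)"
      proof (cases "j \<le> n")
        case True
        have "Suc j * (n choose Suc j) = (n - j) * (n choose j)"
          using binomial_absorption[of j n] binomial_absorb_comp[of n j] by simp
        then show ?thesis using True
          by (metis of_nat_1 of_nat_add of_nat_diff of_nat_mult Suc_eq_plus1)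
      qed (auto simp: binomial_eq_0)
      have IH: "c (Suc j) = (- 1) ^ (n + j + 1) * real (n choose Suc j) * g / ((real j + \<alpha> + 1) * h)"
        "c j = (- 1) ^ (n + j) * real (n choose j) * g / h"
        using Suc.IH[of "Suc j"] Suc.IH[of j] unfolding h(2) by (simp_all add: c_def g_def h_def)
      have "coeff (laguerre_monic \<alpha> (Suc n)) i = - (real n + \<alpha> + 1) * c (Suc j) + c j - (real j + 1) * c (Suc j)"
        by (simp add: Suc c_def coeff_pderiv algebra_simps)
      also have "c j = (- 1) ^ (n + j) * g / ((real j + \<alpha> + 1) * h) * ((real j + \<alpha> + 1) * real (n choose j))"
        using j1 by (simp add: IH(2))
      also have "- (real n + \<alpha> + 1) * c (Suc j) + (- 1) ^ (n + j) * g / ((real j + \<alpha> + 1) * h) * ((real j + \<alpha> + 1) * real (n choose j))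
          - (real j + 1) * c (Suc j) = (- 1) ^ (n + j) * g / ((real j + \<alpha> + 1) * h) *
          ((real n + \<alpha> + 1) * real (n choose Suc j) + (real j + \<alpha> + 1) * real (n choose j)
            + (real j + 1) * real (n choose Suc j))"
        unfolding IH(1) by (simp add: ring_distribs add_divide_distrib diff_divide_distrib mult_ac)
      also have "(real n + \<alpha> + 1) * real (n choose Suc j) + (real j + \<alpha> + 1) * real (n choose j)
            + (real j + 1) * real (n choose Suc j) = (real n + \<alpha> + 1) * real (Suc n choose Suc j)"
        unfolding absorb by (simp add: algebra_simps)
      finally show ?thesis unfolding \<open>i = Suc j\<close> G h(2) by (simp add: mult_ac)
    qed
  }
qed

lemma laguerre_monic_degree:
  assumes "\<alpha> > -1"
  shows "degree (laguerre_monic \<alpha> n) = n" "coeff (laguerre_monic \<alpha> n) n = 1"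
proof -
  have pos: "Gamma (real n + \<alpha> + 1) > 0"
    using assms by (intro Gamma_real_pos) linarith
  show *: "coeff (laguerre_monic \<alpha> n) n = 1"
    using pos by (simp add: coeff_laguerre_monic[OF assms])
  have "degree (laguerre_monic \<alpha> n) \<le> n"
    by (intro degree_le allI impI) (simp add: coeff_laguerre_monic[OF assms])
  moreover have "degree (laguerre_monic \<alpha> n) \<ge> n" using * by (intro le_degree) simp
  ultimately show "degree (laguerre_monic \<alpha> n) = n" by simp
qed

text \<open>Rolle's count in abstract form: inserting a new maximum opens one gap to the right of
  all earlier points, so the zero found in it is new.\<close>

lemma zeros_in_gaps:
  fixes S :: "real set"
  assumes "finite S" "S \<noteq> {}"
    and "\<And>a b. a \<in> S \<Longrightarrow> b \<in> S \<Longrightarrow> a < b \<Longrightarrow> \<exists>z. a < z \<and> z < b \<and> Q z"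
  shows "\<exists>T. finite T \<and> card S = Suc (card T) \<and> (\<forall>z\<in>T. Q z \<and> Min S < z \<and> z < Max S)"
  using assms
proof (induction S rule: finite_linorder_max_induct)
  case empty
  then show ?case by simp
next
  case (insert b S)
  show ?case
  proof (cases "S = {}")
    case True
    then show ?thesis by (intro exI[of _ "{}"]) auto
  next
    case False
    with insert.IH insert.prems obtain T where T: "finite T" "card S = Suc (card T)"
      "\<forall>z\<in>T. Q z \<and> Min S < z \<and> z < Max S" by blast
    have "Max S \<in> S" "Min S \<in> S" using insert.hyps False by auto
    with insert obtain z where z: "Max S < z" "z < b" "Q z" by blast
    have "Min S \<le> Max S" using \<open>Max S \<in> S\<close> insert.hyps by simp
    have "Max (insert b S) = b"
      using insert.hyps by (intro Max_eqI) (auto intro: less_imp_le)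
    moreover have "Min (insert b S) = Min S"
      using insert.hyps False bspec[OF insert.hyps(2) \<open>Min S \<in> S\<close>] by simp
    ultimately have Mm: "Max (insert b S) = b" "Min (insert b S) = Min S" by simp_all
    have "b \<notin> S" "z \<notin> T" using insert.hyps T z by force+
    then show ?thesis
      unfolding Mm using T z insert.hyps \<open>Min S \<le> Max S\<close>
      by (intro exI[of _ "insert z T"]) force
  qed
qed

lemma poly_prod_roots: "poly (\<Prod>r\<in>S. [:- r, 1:]) x = (\<Prod>r\<in>S. x - (r::real))"
  unfolding poly_prod by (intro prod.cong) (auto simp: algebra_simps)

text \<open>Up to a nonvanishing factor, \<open>Q\<close> is the derivative of \<open>x powr c * exp (- x) * P\<close>, which vanishes
  at \<open>0\<close> and at the roots of \<open>P\<close>; the root beyond the largest root of \<open>P\<close> comes from the sign of \<open>Q\<close> there.\<close>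
lemma laguerre_monic_step:
  assumes c: "c > (0::real)" and S: "finite S" "\<forall>r\<in>S. r > 0"
    and P: "P = (\<Prod>r\<in>S. [:- r, 1:])" and Q: "Q = [:- c, 1:] * P - [:0, 1:] * pderiv P"
    and monic: "degree Q = Suc (card S)" "coeff Q (Suc (card S)) = 1"
  shows "\<exists>T. finite T \<and> card T = Suc (card S) \<and> (\<forall>r\<in>T. r > 0) \<and> Q = (\<Prod>r\<in>T. [:- r, 1:])"
proof -
  define h where "h = (\<lambda>x. x powr c * exp (- x) * poly P x)"
  define S0 where "S0 = insert 0 S"
  have S0: "finite S0" "S0 \<noteq> {}" "0 \<in> S0" "0 \<notin> S" "card S0 = Suc (card S)" "\<And>a. a \<in> S0 \<Longrightarrow> a \<ge> 0"
    using S by (force simp: S0_def)+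
  have h0: "h a = 0" if "a \<in> S0" for a
    using that S by (auto simp: h_def S0_def P poly_prod_roots)
  have "\<exists>z. a < z \<and> z < b \<and> poly Q z = 0" if ab: "a \<in> S0" "b \<in> S0" "a < b" for a b
  proof -
    have "a \<ge> 0" using S0 ab by auto
    define D where "D = (\<lambda>x. - (x powr (c - 1) * exp (- x) * poly Q x))"
    have der: "(h has_real_derivative D x) (at x)" if "a < x" for x
    proof -
      have "x > 0" using that \<open>a \<ge> 0\<close> by simp
      then have "x powr c = x * x powr (c - 1)" by (simp add: powr_diff)
      with \<open>x > 0\<close> show ?thesis
        unfolding h_def D_def
        by (auto intro!: derivative_eq_intros poly_DERIV simp: Q algebra_simps)
    qed
    have "\<exists>z. a < z \<and> z < b \<and> (\<lambda>v. D z * v) = (\<lambda>v. 0)"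
    proof (rule Rolle_deriv[OF ab(3)])
      show "continuous_on {a..b} h"
        unfolding h_def using c \<open>a \<ge> 0\<close> by (intro continuous_intros continuous_on_powr') auto
      show "(h has_derivative (\<lambda>v. D x * v)) (at x)" if "a < x" "x < b" for x
        using der[OF that(1)] by (simp add: has_field_derivative_def)
    qed (use h0 ab in auto)
    then obtain z where z: "a < z" "z < b" "D z = 0"
      by (auto dest: fun_cong[of _ _ 1])
    then show ?thesis using \<open>a \<ge> 0\<close> by (intro exI[of _ z]) (auto simp: D_def)
  qed
  with zeros_in_gaps[of S0 "\<lambda>z. poly Q z = 0", OF S0(1,2)] obtain T where T: "finite T" "card S0 = Suc (card T)"
    "\<forall>z\<in>T. poly Q z = 0 \<and> Min S0 < z \<and> z < Max S0" by blast
  have Min0: "Min S0 = 0" using S0 by (intro Min_eqI) auto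
  define m where "m = Max S0"
  have "m \<in> S0" using S0 by (auto simp: m_def)
  \<comment> \<open>At the largest root m of P only -m P'(m) survives, and P'(m) is a product of
    positive differences; if P has no roots, m = 0 and the value is -c. Being monic, Q changes sign
    beyond m.\<close>
  have Qm: "poly Q m < 0"
  proof (cases "m = 0")
    case True
    then have "S = {}" using S S0 Max_ge[OF S0(1)] unfolding m_def S0_def by (metis S0_def insertI2 leD equals0I)
    then show ?thesis using c True by (simp add: Q P)
  next
    case False
    then have "m \<in> S" "m > 0" using \<open>m \<in> S0\<close> S by (auto simp: S0_def)
    define P1 where "P1 = (\<Prod>r\<in>S - {m}. [:- r, 1:])"
    have PP1: "P = [:- m, 1:] * P1"
      unfolding P P1_def using \<open>m \<in> S\<close> S by (simp add: prod.remove)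
    have "poly P1 m > 0"
      unfolding P1_def poly_prod_roots
    proof (rule prod_pos)
      fix r assume "r \<in> S - {m}"
      then show "0 < m - r" using Max_ge[OF S0(1), of r] by (force simp: m_def S0_def)
    qed
    moreover have "poly Q m = - m * poly P1 m"
      unfolding Q PP1 pderiv_mult by (simp add: pderiv_pCons)
    ultimately show ?thesis using \<open>m > 0\<close> by simp
  qed
  have "lead_coeff Q > 0" using monic by simp
  from poly_pinfty_gt_lc[OF this] obtain N where N: "\<And>x. x \<ge> N \<Longrightarrow> poly Q x \<ge> lead_coeff Q" by auto
  have "poly Q (max N (m + 1)) > 0"
    using N[of "max N (m + 1)"] monic by simp
  then obtain z where z: "z > m" "poly Q z = 0"
    using poly_IVT_pos[of m "max N (m + 1)" Q] Qm by (auto simp: less_max_iff_disj)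
  define U where "U = insert z T"
  have "z \<notin> T" using T z unfolding m_def by force
  then have U: "finite U" "card U = Suc (card S)" "\<forall>r\<in>U. r > 0" "\<And>r. r \<in> U \<Longrightarrow> poly Q r = 0"
    using T S0(5) z S0(6)[OF \<open>m \<in> S0\<close>] unfolding U_def Min0 by auto
  have dU: "degree (\<Prod>r\<in>U. [:- r, 1:]) = card U" "lead_coeff (\<Prod>r\<in>U. [:- r, 1:]) = 1"
    by (subst degree_prod_sum_eq; simp) (simp add: lead_coeff_prod)
  \<comment> \<open>Two monic polynomials of degree \<open>card U\<close> that agree at
    \<open>card U\<close> points are equal.\<close>
  have "Q = (\<Prod>r\<in>U. [:- r, 1:])"
  proof (rule poly_eqI_degree_lead_coeff[of _ "Suc (card S)" _ U])
    show "coeff Q (Suc (card S)) = coeff (\<Prod>r\<in>U. [:- r, 1:]) (Suc (card S))"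
      using dU U monic by simp
  qed (use dU U monic in \<open>auto simp: poly_prod\<close>)
  with U show ?thesis by blast
qed

lemma laguerre_monic_roots:
  assumes "\<alpha> > -1"
  shows "\<exists>S. finite S \<and> card S = n \<and> (\<forall>r\<in>S. r > 0) \<and> laguerre_monic \<alpha> n = (\<Prod>r\<in>S. [:- r, 1:])"
proof (induction n)
  case 0
  show ?case by (intro exI[of _ "{}"]) auto
next
  case (Suc n)
  then obtain S where "finite S" "card S = n" "\<forall>r\<in>S. r > 0"
    "laguerre_monic \<alpha> n = (\<Prod>r\<in>S. [:- r, 1:])" by blast
  with laguerre_monic_step[of "real n + \<alpha> + 1" S "laguerre_monic \<alpha> n" "laguerre_monic \<alpha> (Suc n)"]
    laguerre_monic_degree[OF assms, of "Suc n"] assms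
  show ?case by auto
qed

section \<open>Limits of real-rooted functions\<close>

text \<open>Writing L for the sum of 1/(t - r), the identity G' = G L holds on the open complement
  of S and can therefore be differentiated once more at x. The derivatives enter as given functions
  because the application knows them as power series.\<close>

lemma log_deriv_prod:
  fixes c :: real
  assumes "finite S" and G: "\<And>t. G t = c * (\<Prod>r\<in>S. t - r)"
    and dG: "\<And>t. (G has_real_derivative G1 t) (at t)"
    and dG1: "(G1 has_real_derivative G2) (at x)"
    and x: "x \<notin> S"
  shows "G1 x = G x * (\<Sum>r\<in>S. 1 / (x - r))"
    and "(G1 x)\<^sup>2 - G x * G2 = (G x)\<^sup>2 * (\<Sum>r\<in>S. 1 / (x - r)\<^sup>2)"
proof -
  define L where "L = (\<lambda>t. \<Sum>r\<in>S. 1 / (t - r))"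
  have G1: "G1 t = G t * L t" if "t \<notin> S" for t
  proof -
    have "((\<lambda>t. c * (\<Prod>r\<in>S. t - r)) has_real_derivative c * (\<Sum>r\<in>S. 1 * (\<Prod>s\<in>S - {r}. t - s))) (at t)"
      by (intro DERIV_cmult has_field_derivative_prod) (auto intro!: derivative_eq_intros)
    moreover have "(\<Sum>r\<in>S. 1 * (\<Prod>s\<in>S - {r}. t - s)) = (\<Prod>r\<in>S. t - r) * L t"
      unfolding L_def sum_distrib_left
      using that \<open>finite S\<close> by (intro sum.cong) (auto simp: prod.remove)
    ultimately have "(G has_real_derivative G t * L t) (at t)"
      using G by (simp add: mult.assoc flip: G[abs_def])
    with dG show ?thesis by (rule DERIV_unique)
  qed
  then show "G1 x = G x * (\<Sum>r\<in>S. 1 / (x - r))" using x by (simp add: L_def)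
  have "open (- S)" using \<open>finite S\<close> by (simp add: finite_imp_closed open_Compl)
  have "(L has_real_derivative (\<Sum>r\<in>S. - (1 / (x - r)\<^sup>2))) (at x)"
    unfolding L_def using x
    by (intro DERIV_sum) (auto intro!: derivative_eq_intros simp: power2_eq_square)
  then have "((\<lambda>t. G t * L t) has_real_derivative G1 x * L x + (\<Sum>r\<in>S. - (1 / (x - r)\<^sup>2)) * G x) (at x)"
    by (rule DERIV_mult[OF dG])
  moreover have "eventually (\<lambda>t. G1 t = G t * L t) (nhds x)"
    using eventually_nhds_in_open[OF \<open>open (- S)\<close>, of x] x G1 by (auto elim!: eventually_mono)
  ultimately have "(G1 has_real_derivative G1 x * L x + (\<Sum>r\<in>S. - (1 / (x - r)\<^sup>2)) * G x) (at x)"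
    using DERIV_cong_ev[OF refl _ refl, of G1 "\<lambda>t. G t * L t" x] by simp
  then have "G2 = G1 x * L x - (\<Sum>r\<in>S. 1 / (x - r)\<^sup>2) * G x"
    using DERIV_unique[OF dG1] by (simp add: sum_negf)
  then show "(G1 x)\<^sup>2 - G x * G2 = (G x)\<^sup>2 * (\<Sum>r\<in>S. 1 / (x - r)\<^sup>2)"
    unfolding G1[OF x] by (simp add: power2_eq_square left_diff_distrib right_diff_distrib mult_ac)
qed

text \<open>The approximants \<open>G n\<close> have simple positive roots, listed in
  \<open>S n\<close>. Uniform convergence of \<open>G\<close> keeps roots away from where f is
  nonzero, that of \<open>G1\<close> prevents two roots from merging at a simple zero of f; second
  derivatives enter only at the single point x, so pointwise convergence is enough for them. The
  bound K makes the contribution of large roots uniformly small.\<close>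

locale real_rooted_limit =
  fixes f f1 f2 :: "real \<Rightarrow> real" and G G1 G2 :: "nat \<Rightarrow> real \<Rightarrow> real"
    and S :: "nat \<Rightarrow> real set" and c :: "nat \<Rightarrow> real" and K :: real
  assumes df: "\<And>t. (f has_real_derivative f1 t) (at t)"
    and df1: "\<And>t. (f1 has_real_derivative f2 t) (at t)"
    and dG: "\<And>n t. (G n has_real_derivative G1 n t) (at t)"
    and dG1: "\<And>n t. (G1 n has_real_derivative G2 n t) (at t)"
    and fin_S: "\<And>n. finite (S n)" and S_pos: "\<And>n r. r \<in> S n \<Longrightarrow> r > 0"
    and c_nz: "\<And>n. c n \<noteq> 0" and G_prod: "\<And>n t. G n t = c n * (\<Prod>r\<in>S n. t - r)"
    and u0: "\<And>T. uniform_limit {0..T} G f sequentially"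
    and u1: "\<And>T. uniform_limit {0..T} G1 f1 sequentially"
    and l2: "\<And>t. t \<ge> 0 \<Longrightarrow> (\<lambda>n. G2 n t) \<longlonglongrightarrow> f2 t"
    and sum_recip: "\<And>n. (\<Sum>r\<in>S n. 1 / r) \<le> K"
    and f_0: "f 0 \<noteq> 0"
    and simple: "\<And>a. a > 0 \<Longrightarrow> f a = 0 \<Longrightarrow> f1 a \<noteq> 0"
    and fin_Z: "\<And>X. finite {a. 0 < a \<and> a \<le> X \<and> f a = 0}"
begin

lemma G_zero_iff: "G n t = 0 \<longleftrightarrow> t \<in> S n"
  using c_nz fin_S by (auto simp: G_prod)

lemma cont_f: "continuous_on A f" and cont_f1: "continuous_on A f1" and cont_G: "continuous_on A (G n)"
  using df df1 dG by (auto intro!: continuous_at_imp_continuous_on DERIV_isCont)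

lemma l0: "t \<ge> 0 \<Longrightarrow> (\<lambda>n. G n t) \<longlonglongrightarrow> f t" and l1: "t \<ge> 0 \<Longrightarrow> (\<lambda>n. G1 n t) \<longlonglongrightarrow> f1 t"
  using tendsto_uniform_limitI[OF u0[of t]] tendsto_uniform_limitI[OF u1[of t]] by auto

text \<open>On a nonempty compact set |g| has a positive minimum, and an approximation with smaller
  error has no zero.\<close>

lemma eventually_nz_compact:
  fixes g :: "real \<Rightarrow> real"
  assumes "uniform_limit {0..T} H g sequentially" "C \<subseteq> {0..T}" "compact C" "continuous_on C g"
    "\<And>t. t \<in> C \<Longrightarrow> g t \<noteq> 0"
  shows "eventually (\<lambda>n. \<forall>t\<in>C. H n t \<noteq> 0) sequentially"
proof (cases "C = {}")
  case False
  obtain s where s: "s \<in> C" "\<And>t. t \<in> C \<Longrightarrow> \<bar>g s\<bar> \<le> \<bar>g t\<bar>"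
    using continuous_attains_inf[OF assms(3) False, of "\<lambda>t. \<bar>g t\<bar>"] assms(4)
    by (auto intro: continuous_intros)
  have "\<bar>g s\<bar> > 0" using s assms by auto
  from uniform_limitD[OF assms(1) this] show ?thesis
  proof eventually_elim
    case (elim n)
    show ?case
    proof
      fix t assume t: "t \<in> C"
      with elim assms(2) have "dist (H n t) (g t) < \<bar>g s\<bar>" by blast
      with s(2)[OF t] show "H n t \<noteq> 0" by (auto simp: dist_real_def)
    qed
  qed
qed auto

text \<open>Hurwitz's theorem on the real line. The sign change at a simple zero forces a root of
  \<open>G n\<close> nearby; two such roots would yield a zero of \<open>G1 n\<close> by Rolle, but
  \<open>G1 n\<close> is close to \<open>f1\<close>, which does not vanish there.\<close>

lemma track_zero:
  assumes a: "a > 0" "f a = 0"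
  shows "\<exists>\<delta> \<rho>. \<delta> > 0 \<and> \<rho> \<longlonglongrightarrow> a \<and> eventually (\<lambda>n. {r \<in> S n. \<bar>r - a\<bar> \<le> \<delta>} = {\<rho> n}) sequentially"
proof -
  have f1a: "f1 a \<noteq> 0" using simple[OF a] .
  have "isCont f1 a" using df1 DERIV_isCont by blast
  then have "eventually (\<lambda>t. f1 t \<noteq> 0) (nhds a)"
    using f1a by (auto simp: continuous_within intro!: tendsto_imp_eventually_ne simp: tendsto_at_iff_tendsto_nhds)
  then obtain d1 where d1: "d1 > 0" "\<And>t. \<bar>t - a\<bar> < d1 \<Longrightarrow> f1 t \<noteq> 0"
    by (auto simp: eventually_nhds_metric dist_real_def)
  \<comment> \<open>The factor \<open>f1 a\<close> treats upward and downward crossings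
    together.\<close>
  have "((\<lambda>t. (f t - f a) / (t - a) * f1 a) \<longlongrightarrow> f1 a * f1 a) (at a)"
    using df[of a] by (intro tendsto_intros) (simp add: has_field_derivative_iff)
  moreover have "f1 a * f1 a > 0" using f1a by (metis not_real_square_gt_zero)
  ultimately have "eventually (\<lambda>t. (f t - f a) / (t - a) * f1 a > 0) (at a)"
    by (rule order_tendstoD)
  then obtain d2 where d2: "d2 > 0" "\<And>t. t \<noteq> a \<Longrightarrow> \<bar>t - a\<bar> < d2 \<Longrightarrow> f t / (t - a) * f1 a > 0"
    using a by (auto simp: eventually_at dist_real_def)
  \<comment> \<open>Staying below a keeps the interval around a inside the positive axis, where
    uniform convergence is available.\<close>
  define \<delta> where "\<delta> = min a (min d1 d2) / 2"
  have \<delta>: "\<delta> > 0" "\<delta> < a" "\<delta> < d1" "\<delta> < d2" using a d1 d2 by (auto simp: \<delta>_def)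
  have ex: "eventually (\<lambda>n. \<exists>r\<in>S n. \<bar>r - a\<bar> \<le> e) sequentially" if e: "0 < e" "e \<le> \<delta>" for e
  proof -
    have L: "(\<lambda>n. G n (a + e) * f1 a) \<longlonglongrightarrow> f (a + e) * f1 a" "(\<lambda>n. G n (a - e) * f1 a) \<longlonglongrightarrow> f (a - e) * f1 a"
      using l0 e \<delta> by (auto intro!: tendsto_intros)
    have "f (a + e) * f1 a > 0" "f (a - e) * f1 a < 0"
      using d2(2)[of "a + e"] d2(2)[of "a - e"] e \<delta>
      by (auto simp: zero_less_mult_iff mult_less_0_iff divide_less_0_iff zero_less_divide_iff)
    from order_tendstoD(1)[OF L(1) this(1)] order_tendstoD(2)[OF L(2) this(2)]
     show ?thesis
    proof eventually_elim
      case (elim n)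
      have "\<exists>r. a - e \<le> r \<and> r \<le> a + e \<and> G n r * f1 a = 0"
        using elim e by (intro IVT') (auto intro!: continuous_intros cont_G)
      then show ?case using f1a by (auto simp: G_zero_iff abs_le_iff intro!: bexI)
    qed
  qed
  have "eventually (\<lambda>n. \<forall>t\<in>{a - \<delta>..a + \<delta>}. G1 n t \<noteq> 0) sequentially"
    using \<delta> d1(2) by (intro eventually_nz_compact[OF u1[of "a + \<delta>"]] cont_f1) (auto simp: abs_less_iff)
  then have uniq: "eventually (\<lambda>n. \<forall>r\<in>S n. \<forall>s\<in>S n. \<bar>r - a\<bar> \<le> \<delta> \<longrightarrow> \<bar>s - a\<bar> \<le> \<delta> \<longrightarrow> r = s) sequentially"
  proof eventually_elim
    case (elim n)
    have False if rs: "r \<in> S n" "s \<in> S n" "\<bar>r - a\<bar> \<le> \<delta>" "\<bar>s - a\<bar> \<le> \<delta>" "r < s" for r s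
    proof -
      have "\<exists>z. r < z \<and> z < s \<and> (\<lambda>v. G1 n z * v) = (\<lambda>v. 0)"
        using rs dG[of n] G_zero_iff[of n r] G_zero_iff[of n s]
        by (intro Rolle_deriv[where f = "G n"]) (auto intro!: cont_G simp: has_field_derivative_def)
      then obtain z where "r < z" "z < s" "G1 n z = 0" by (auto dest: fun_cong[of _ _ 1])
      then show False using elim rs by (auto simp: abs_le_iff)
    qed
    then show ?case by (metis linorder_neqE_linordered_idom)
  qed
  define \<rho> where "\<rho> = (\<lambda>n. SOME r. r \<in> S n \<and> \<bar>r - a\<bar> \<le> \<delta>)"
  have single: "eventually (\<lambda>n. {r \<in> S n. \<bar>r - a\<bar> \<le> \<delta>} = {\<rho> n}) sequentially"
    using uniq ex[OF \<delta>(1) order_refl]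
  proof eventually_elim
    case (elim n)
    from elim(2) have "\<exists>r. r \<in> S n \<and> \<bar>r - a\<bar> \<le> \<delta>" by auto
    then have "\<rho> n \<in> S n \<and> \<bar>\<rho> n - a\<bar> \<le> \<delta>" unfolding \<rho>_def by (rule someI_ex)
    with elim(1) show ?case by blast
  qed
  have "\<rho> \<longlonglongrightarrow> a"
  proof (rule tendstoI)
    fix e :: real assume "e > 0"
    define e' where "e' = min \<delta> (e / 2)"
    have "0 < e'" "e' \<le> \<delta>" "e' < e" using \<open>e > 0\<close> \<delta> by (auto simp: e'_def)
    from single ex[OF this(1,2)] show "eventually (\<lambda>n. dist (\<rho> n) a < e) sequentially"
    proof eventually_elim
      case (elim n)
      then obtain r where "r \<in> S n" "\<bar>r - a\<bar> \<le> e'" by blast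
      with elim(1) \<open>e' \<le> \<delta>\<close> have "r = \<rho> n" by (metis (mono_tags, lifting) mem_Collect_eq order_trans singletonD)
      with \<open>\<bar>r - a\<bar> \<le> e'\<close> \<open>e' < e\<close> show ?case by (simp add: dist_real_def)
    qed
  qed
  with single \<delta>(1) show ?thesis by blast
qed

text \<open>This is -(f1/f)' at x.\<close>

definition "D x = ((f1 x)\<^sup>2 - f x * f2 x) / (f x)\<^sup>2"

text \<open>For large \<open>n\<close>, the roots of \<open>G n\<close> up to \<open>X\<close> correspond to the zeros of \<open>f\<close> up to \<open>X\<close>; each further
  root \<open>r\<close> has \<open>r - x \<ge> r/2\<close> and contributes at most \<open>4/(X r)\<close>.\<close>
lemma partial_sums:
  assumes x: "x \<ge> 0" "f x \<noteq> 0" and X: "X > 0" "X > 2 * x"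
  shows "(\<Sum>a | 0 < a \<and> a \<le> X \<and> f a = 0. 1 / (a - x)\<^sup>2) \<le> D x"
    and "D x \<le> (\<Sum>a | 0 < a \<and> a \<le> X \<and> f a = 0. 1 / (a - x)\<^sup>2) + 4 * K / X"
proof -
  define W where "W = {a. 0 < a \<and> a \<le> X \<and> f a = 0}"
  have fin_W: "finite W" unfolding W_def by (rule fin_Z)
  have "\<forall>a\<in>W. \<exists>\<delta> \<rho>. \<delta> > 0 \<and> \<rho> \<longlonglongrightarrow> a \<and> eventually (\<lambda>n. {r \<in> S n. \<bar>r - a\<bar> \<le> \<delta>} = {\<rho> n}) sequentially"
    using track_zero by (auto simp: W_def)
  from bchoice[OF this] obtain \<delta> where "\<forall>a\<in>W. \<exists>\<rho>. \<delta> a > 0 \<and> \<rho> \<longlonglongrightarrow> a \<and>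
      eventually (\<lambda>n. {r \<in> S n. \<bar>r - a\<bar> \<le> \<delta> a} = {\<rho> n}) sequentially" by blast
  from bchoice[OF this] obtain \<rho> where \<delta>: "\<And>a. a \<in> W \<Longrightarrow> \<delta> a > 0" and \<rho>: "\<And>a. a \<in> W \<Longrightarrow> \<rho> a \<longlonglongrightarrow> a"
    and single: "\<And>a. a \<in> W \<Longrightarrow> eventually (\<lambda>n. {r \<in> S n. \<bar>r - a\<bar> \<le> \<delta> a} = {\<rho> a n}) sequentially"
    by blast
  \<comment> \<open>Eventually \<open>G n\<close> has no root in C, so each of its roots up to X
    lies close to a zero in W and is the one tracked there.\<close>
  define C where "C = {0..X} - (\<Union>a\<in>W. ball a (\<delta> a))"
  have C: "compact C" "C \<subseteq> {0..X}" unfolding C_def by (auto intro!: compact_diff open_UN)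
  have "f t \<noteq> 0" if "t \<in> C" for t
    using that \<delta> f_0 unfolding C_def W_def by (cases "t = 0") force+
  with C have evC: "eventually (\<lambda>n. \<forall>t\<in>C. G n t \<noteq> 0) sequentially"
    by (intro eventually_nz_compact[OF u0[of X]] cont_f) auto
  have ev1: "eventually (\<lambda>n. \<forall>a\<in>W. {r \<in> S n. \<bar>r - a\<bar> \<le> \<delta> a} = {\<rho> a n}) sequentially"
    using single fin_W by (intro eventually_ball_finite) auto
  \<comment> \<open>The neighbourhoods of different zeros may overlap, but distinct limits separate
    the tracked roots. Hence the sum over W is a sum over distinct roots.\<close>
  have ev2: "eventually (\<lambda>n. \<forall>a\<in>W. \<forall>b\<in>W - {a}. \<rho> a n \<noteq> \<rho> b n) sequentially"
  proof (intro eventually_ball_finite ballI)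
    fix a b assume ab: "a \<in> W" "b \<in> W - {a}"
    have "(\<lambda>n. \<rho> a n - \<rho> b n) \<longlonglongrightarrow> a - b" using \<rho> ab by (intro tendsto_intros) auto
    then have "eventually (\<lambda>n. \<rho> a n - \<rho> b n \<noteq> 0) sequentially"
      using ab by (intro tendsto_imp_eventually_ne) auto
    then show "eventually (\<lambda>n. \<rho> a n \<noteq> \<rho> b n) sequentially" by eventually_elim auto
  qed (use fin_W in auto)
  have ev3: "eventually (\<lambda>n. G n x \<noteq> 0) sequentially"
    using l0[OF x(1)] x(2) by (rule tendsto_imp_eventually_ne)
  define s where "s = (\<lambda>n. \<Sum>a\<in>W. 1 / (\<rho> a n - x)\<^sup>2)"
  define Dn where "Dn = (\<lambda>n. ((G1 n x)\<^sup>2 - G n x * G2 n x) / (G n x)\<^sup>2)"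
  have bounds: "eventually (\<lambda>n. s n \<le> Dn n \<and> Dn n \<le> s n + 4 * K / X) sequentially"
    using evC ev1 ev2 ev3
  proof eventually_elim
    case (elim n)
    have "x \<notin> S n" using elim(4) by (simp add: G_zero_iff)
    from log_deriv_prod(2)[OF fin_S G_prod dG dG1 this] elim(4)
    have Dn: "Dn n = (\<Sum>r\<in>S n. 1 / (r - x)\<^sup>2)"
      by (simp add: Dn_def power2_commute)
    define R where "R = (\<lambda>a. \<rho> a n) ` W"
    have inj: "inj_on (\<lambda>a. \<rho> a n) W" using elim(3) by (auto simp: inj_on_def)
    have s: "s n = (\<Sum>r\<in>R. 1 / (r - x)\<^sup>2)"
      unfolding s_def R_def by (simp add: sum.reindex[OF inj])
    have RS: "R \<subseteq> S n" using elim(2) by (auto simp: R_def)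
    have big: "r > X" if r: "r \<in> S n - R" for r
    proof (rule ccontr)
      assume "\<not> X < r"
      moreover have "r \<notin> C" using elim(1) r by (auto simp: G_zero_iff)
      moreover have "r > 0" using S_pos r by auto
      ultimately obtain a where "a \<in> W" "\<bar>r - a\<bar> \<le> \<delta> a"
        by (auto simp: C_def dist_real_def abs_minus_commute)
      with elim(2) r have "r = \<rho> a n" by blast
      with r \<open>a \<in> W\<close> show False by (auto simp: R_def)
    qed
    have "Dn n = s n + (\<Sum>r\<in>S n - R. 1 / (r - x)\<^sup>2)"
      unfolding Dn s using RS fin_S by (metis add.commute sum.subset_diff)
    moreover have "(\<Sum>r\<in>S n - R. 1 / (r - x)\<^sup>2) \<ge> 0" by (intro sum_nonneg) auto
    moreover have "(\<Sum>r\<in>S n - R. 1 / (r - x)\<^sup>2) \<le> (\<Sum>r\<in>S n - R. 4 / X * (1 / r))"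
    proof (rule sum_mono)
      fix r assume "r \<in> S n - R"
      from big[OF this] have r: "r > X" .
      have "(r / 2)\<^sup>2 \<le> (r - x)\<^sup>2" using r X x by (intro power_mono) auto
      moreover have "X * r \<le> r * r" using r X by (intro mult_right_mono) auto
      ultimately have "X * r / 4 \<le> (r - x)\<^sup>2" by (simp add: power2_eq_square)
      moreover have "X * r / 4 > 0" using r X by simp
      ultimately have "1 / (r - x)\<^sup>2 \<le> 1 / (X * r / 4)"
        by (intro divide_left_mono) (auto intro!: mult_pos_pos)
      then show "1 / (r - x)\<^sup>2 \<le> 4 / X * (1 / r)" by simp
    qed
    moreover have "(\<Sum>r\<in>S n - R. 4 / X * (1 / r)) \<le> (\<Sum>r\<in>S n. 4 / X * (1 / r))"
      using X S_pos fin_S by (intro sum_mono2) (auto simp: less_imp_le)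
    moreover have "(\<Sum>r\<in>S n. 4 / X * (1 / r)) \<le> 4 * K / X"
      using mult_left_mono[OF sum_recip[of n], of "4 / X"] X by (simp add: sum_distrib_left)
    ultimately show ?case by linarith
  qed
  have "\<rho> a \<longlonglongrightarrow> a" "a \<noteq> x" if "a \<in> W" for a using that \<rho> x by (auto simp: W_def)
  then have ls: "s \<longlonglongrightarrow> (\<Sum>a\<in>W. 1 / (a - x)\<^sup>2)"
    unfolding s_def by (intro tendsto_intros) auto
  have lD: "Dn \<longlonglongrightarrow> D x"
    unfolding Dn_def D_def using x by (intro tendsto_intros l0 l1 l2) auto
  show "(\<Sum>a | 0 < a \<and> a \<le> X \<and> f a = 0. 1 / (a - x)\<^sup>2) \<le> D x"
    using bounds unfolding W_def[symmetric]
    by (intro tendsto_le[OF _ lD ls]) (auto elim: eventually_mono)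
  show "D x \<le> (\<Sum>a | 0 < a \<and> a \<le> X \<and> f a = 0. 1 / (a - x)\<^sup>2) + 4 * K / X"
    using bounds unfolding W_def[symmetric]
    by (intro tendsto_le[OF _ tendsto_add[OF ls tendsto_const] lD]) (auto elim: eventually_mono)
qed

lemma has_sum_zeros:
  assumes x: "x \<ge> 0" "f x \<noteq> 0"
  shows "((\<lambda>a. 1 / (a - x)\<^sup>2) has_sum D x) {a. 0 < a \<and> f a = 0}"
proof -
  define Z where "Z = {a. 0 < a \<and> f a = 0}"
  define g where "g = (\<lambda>a. 1 / (a - x)\<^sup>2)"
  have upper: "sum g F \<le> D x" if F: "F \<subseteq> Z" "finite F" for F
  proof -
    \<comment> \<open>The extra point \<open>2 * x + 1\<close> makes X admissible in
      \<open>partial_sums\<close>, also for empty F.\<close>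
    define X where "X = Max (insert (2 * x + 1) F)"
    have X: "X \<ge> 2 * x + 1" "\<And>a. a \<in> F \<Longrightarrow> a \<le> X" using F by (auto simp: X_def)
    have "sum g F \<le> sum g {a. 0 < a \<and> a \<le> X \<and> f a = 0}"
      using F X fin_Z by (intro sum_mono2) (auto simp: Z_def g_def)
    also have "\<dots> \<le> D x" unfolding g_def using X x by (intro partial_sums) auto
    finally show ?thesis .
  qed
  have summ: "g summable_on Z"
    using upper by (intro nonneg_bdd_above_summable_on bdd_aboveI2[of _ _ "D x"]) (auto simp: g_def)
  have "infsum g Z \<le> D x" using summ upper by (intro infsum_le_finite_sums) auto
  moreover have "D x \<le> infsum g Z"
  proof (rule tendsto_lowerbound)
    show "((\<lambda>X. infsum g Z + 4 * K / X) \<longlongrightarrow> infsum g Z) at_top"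
      by (rule tendsto_eq_rhs[OF tendsto_add[OF tendsto_const tendsto_divide_0[OF tendsto_const filterlim_at_top_imp_at_infinity[OF filterlim_ident]]]]) simp
    show "eventually (\<lambda>X. D x \<le> infsum g Z + 4 * K / X) at_top"
      using eventually_gt_at_top[of "2 * x"] eventually_gt_at_top[of 0]
    proof eventually_elim
      case (elim X)
      have "sum g {a. 0 < a \<and> a \<le> X \<and> f a = 0} \<le> infsum g Z"
        using summ fin_Z by (intro finite_sum_le_infsum) (auto simp: Z_def g_def)
      with partial_sums(2)[OF x elim(2,1)] show ?case by (simp add: g_def)
    qed
  qed simp
  ultimately have "infsum g Z = D x" by simp
  with summ show ?thesis unfolding g_def Z_def by (metis has_sum_infsum)
qed

end

text \<open>Ranks of the elements up to x are distinct and lie between 1 and the rank of x, so by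
  counting they fill this range; infinitude makes the ranks unbounded. This is what gives the m-th
  zero a meaning.\<close>

lemma bij_betw_card_le:
  fixes T :: "'a::linorder set"
  assumes inf: "infinite T" and fin: "\<And>x. finite {t \<in> T. t \<le> x}"
  shows "bij_betw (\<lambda>x. card {t \<in> T. t \<le> x}) T {1..}"
proof -
  define c where "c = (\<lambda>x. card {t \<in> T. t \<le> x})"
  have mono: "c x < c y" if "x \<in> T" "y \<in> T" "x < y" for x y
  proof -
    have "y \<in> {t \<in> T. t \<le> y} - {t \<in> T. t \<le> x}" "{t \<in> T. t \<le> x} \<subseteq> {t \<in> T. t \<le> y}"
      using that by auto
    then show ?thesis
      unfolding c_def by (intro psubset_card_mono fin) blast
  qed
  have inj: "inj_on c T"
    using mono by (intro linorder_inj_onI') (metis less_irrefl)+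
  have ge1: "c x \<ge> 1" if "x \<in> T" for x
    using that fin[of x] by (simp add: c_def Suc_le_eq card_gt_0_iff) blast
  have down: "c ` {t \<in> T. t \<le> x} = {1..c x}" if "x \<in> T" for x
  proof (rule card_subset_eq)
    show "c ` {t \<in> T. t \<le> x} \<subseteq> {1..c x}"
      using ge1 mono that by (force simp: le_less)
    show "card (c ` {t \<in> T. t \<le> x}) = card {1..c x}"
      using inj by (subst card_image) (auto simp: c_def intro: inj_on_subset)
  qed simp
  have "{1..} \<subseteq> c ` T"
  proof
    fix m :: nat assume "m \<in> {1..}"
    have "infinite (c ` T)" using inf inj by (simp add: finite_image_iff)
    then obtain x where "x \<in> T" "m \<le> c x"
      by (metis finite_nat_set_iff_bounded_le imageE nat_le_linear)
    then show "m \<in> c ` T" using down[of x] \<open>m \<in> {1..}\<close> by auto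
  qed
  moreover have "c ` T \<subseteq> {1..}" using ge1 by auto
  ultimately show ?thesis using inj unfolding bij_betw_def c_def by blast
qed

section \<open>Partial fractions over the Bessel zeros\<close>

text \<open>One format for the Bessel series (all multipliers 1), for the rescaled Laguerre
  polynomials, and for the derivatives of the latter, where the multipliers are shifted.\<close>

definition damped_F :: "(nat \<Rightarrow> real) \<Rightarrow> real \<Rightarrow> real \<Rightarrow> real" where
  "damped_F m \<nu> t = (\<Sum>i. m i * bessel_coeff \<nu> i * t ^ i)"

lemma summable_damped:
  fixes m :: "nat \<Rightarrow> real"
  assumes "\<nu> > -1" "\<And>i. 0 \<le> m i" "\<And>i. m i \<le> 1"
  shows "summable (\<lambda>i. m i * bessel_coeff \<nu> i * t ^ i)"
proof (rule summable_comparison_test'[OF bessel_coeff_summable[OF assms(1), of "\<bar>t\<bar>"], of 0])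
  fix i :: nat
  have "m i * (\<bar>bessel_coeff \<nu> i\<bar> * \<bar>t\<bar> ^ i) \<le> 1 * (\<bar>bessel_coeff \<nu> i\<bar> * \<bar>t\<bar> ^ i)"
    using assms by (intro mult_right_mono) auto
  then show "norm (m i * bessel_coeff \<nu> i * t ^ i) \<le> \<bar>bessel_coeff \<nu> i\<bar> * \<bar>t\<bar> ^ i"
    using assms(2)[of i] by (simp add: abs_mult power_abs mult_ac)
qed

lemma damped_F_deriv:
  fixes m :: "nat \<Rightarrow> real"
  assumes "\<nu> > -1" "\<And>i. 0 \<le> m i" "\<And>i. m i \<le> 1"
  shows "(damped_F m \<nu> has_real_derivative - damped_F (\<lambda>i. m (Suc i)) (\<nu> + 1) t / 4) (at t)"
proof -
  have "diffs (\<lambda>i. m i * bessel_coeff \<nu> i) i = -(1/4) * (m (Suc i) * bessel_coeff (\<nu> + 1) i)" for i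
    using diffs_bessel_coeff[of \<nu> i] unfolding diffs_def by (simp add: mult_ac)
  then have "(\<Sum>i. diffs (\<lambda>i. m i * bessel_coeff \<nu> i) i * t ^ i) =
      (\<Sum>i. -(1/4) * (m (Suc i) * bessel_coeff (\<nu> + 1) i * t ^ i))"
    by (simp add: mult.assoc)
  also have "\<dots> = - damped_F (\<lambda>i. m (Suc i)) (\<nu> + 1) t / 4"
    unfolding damped_F_def using summable_damped[where \<nu> = "\<nu> + 1" and m = "\<lambda>i. m (Suc i)" and t = t] assms
    by (subst suminf_mult) auto
  finally show ?thesis
    using termdiffs_strong_converges_everywhere[of "\<lambda>i. m i * bessel_coeff \<nu> i" t, OF summable_damped[OF assms]]
    by (simp add: damped_F_def[abs_def])
qed

text \<open>On [0, T] the error is at most the sum of \<open>(1 - m n i) * M i\<close> with M the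
  majorant at T. This bound is free of t and tends to 0 by Tannery's theorem.\<close>

lemma uniform_limit_damped_F:
  fixes m :: "nat \<Rightarrow> nat \<Rightarrow> real"
  assumes \<nu>: "\<nu> > -1" and m: "\<And>n i. 0 \<le> m n i" "\<And>n i. m n i \<le> 1"
    and lim: "\<And>i. (\<lambda>n. m n i) \<longlonglongrightarrow> 1"
  shows "uniform_limit {0..T} (\<lambda>n. damped_F (m n) \<nu>) (bessel_F \<nu>) sequentially"
proof (cases "T \<ge> 0")
  case True
  define M where "M = (\<lambda>i. \<bar>bessel_coeff \<nu> i\<bar> * T ^ i)"
  have M: "summable M" "\<And>i. M i \<ge> 0"
    using bessel_coeff_summable[OF \<nu>] True by (auto simp: M_def)
  have aM: "\<bar>(1 - m n i) * M i\<bar> \<le> M i" for n i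
    using m[of n i] M(2)[of i] by (auto simp: abs_mult intro!: mult_left_le_one_le)
  have a_sum: "summable (\<lambda>i. (1 - m n i) * M i)" for n
    by (rule summable_comparison_test'[OF M(1), of 0]) (use aM in auto)
  define e where "e = (\<lambda>n. \<Sum>i. (1 - m n i) * M i)"
  have "(\<lambda>n. (1 - m n i) * M i) \<longlonglongrightarrow> (1 - 1) * M i" for i by (intro tendsto_intros lim)
  then have "e \<longlonglongrightarrow> (\<Sum>i. 0)"
    unfolding e_def using M(1) aM
    by (intro tannerys_theorem[of _ "\<lambda>i. 0" _ M, THEN conjunct2, THEN conjunct2]) (auto intro!: always_eventually)
  then have e0: "e \<longlonglongrightarrow> 0" by simp
  have bound: "dist (damped_F (m n) \<nu> t) (bessel_F \<nu> t) \<le> e n" if t: "t \<in> {0..T}" for n t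
  proof -
    have s: "summable (\<lambda>i. m n i * bessel_coeff \<nu> i * t ^ i)" "summable (\<lambda>i. bessel_coeff \<nu> i * t ^ i)"
      using summable_damped[OF \<nu> m] bessel_F_summable[OF \<nu>] by auto
    have bound_i: "\<bar>m n i * bessel_coeff \<nu> i * t ^ i - bessel_coeff \<nu> i * t ^ i\<bar> \<le> (1 - m n i) * M i" for i
    proof -
      have "\<bar>m n i * bessel_coeff \<nu> i * t ^ i - bessel_coeff \<nu> i * t ^ i\<bar> = \<bar>- ((1 - m n i) * (bessel_coeff \<nu> i * t ^ i))\<bar>"
        by (simp add: algebra_simps)
      also have "\<dots> = (1 - m n i) * (\<bar>bessel_coeff \<nu> i\<bar> * t ^ i)"
        using m(2)[of n i] t by (simp add: abs_mult)
      also have "\<dots> \<le> (1 - m n i) * M i"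
        unfolding M_def using m(2)[of n i] t by (intro mult_left_mono power_mono) auto
      finally show ?thesis .
    qed
    have "damped_F (m n) \<nu> t - bessel_F \<nu> t = (\<Sum>i. m n i * bessel_coeff \<nu> i * t ^ i - bessel_coeff \<nu> i * t ^ i)"
      unfolding damped_F_def bessel_F_def using s by (rule suminf_diff)
    also have "\<bar>\<dots>\<bar> \<le> e n"
      unfolding e_def using norm_suminf_le[OF _ a_sum, of "\<lambda>i. m n i * bessel_coeff \<nu> i * t ^ i - bessel_coeff \<nu> i * t ^ i" n]
        bound_i by simp
    finally show ?thesis by (simp add: dist_real_def)
  qed
  show ?thesis
  proof (rule uniform_limitI)
    fix d :: real assume "d > 0"
    from order_tendstoD(2)[OF e0 this] show "eventually (\<lambda>n. \<forall>t\<in>{0..T}. dist (damped_F (m n) \<nu> t) (bessel_F \<nu> t) < d) sequentially"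
      by eventually_elim (use bound le_less_trans in blast)
  qed
qed auto

text \<open>With N = \<open>Suc n\<close>, this is the falling factorial of N of length i over N^i,
  the ratio of the rescaled Laguerre coefficients to the Bessel coefficients. The successor keeps N
  positive.\<close>

definition damping :: "nat \<Rightarrow> nat \<Rightarrow> real" where
  "damping n i = (\<Prod>j<i. 1 - real j / real (Suc n))"

lemma damping_eq: "damping n i = fact i * real (Suc n choose i) / real (Suc n) ^ i"
proof -
  have "fact i * real (Suc n choose i) = (\<Prod>j<i. real (Suc n) - real j)"
    by (metis atLeast0LessThan binomial_gbinomial gbinomial_mult_fact of_nat_fact)
  also have "\<dots> = (\<Prod>j<i. real (Suc n) * (1 - real j / real (Suc n)))"
    by (intro prod.cong refl) (simp add: right_diff_distrib del: of_nat_Suc)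
  also have "\<dots> = real (Suc n) ^ i * damping n i"
    by (simp add: damping_def prod.distrib del: of_nat_Suc)
  finally show ?thesis by (simp del: of_nat_Suc)
qed

text \<open>Factors with j > \<open>Suc n\<close> are negative, but the product then contains the
  zero factor j = \<open>Suc n\<close> as well; the binomial form makes this visible.\<close>

lemma damping_nonneg: "0 \<le> damping n i"
  unfolding damping_eq by simp

lemma damping_le_1: "damping n i \<le> 1"
proof (induction i)
  case (Suc i)
  have "damping n (Suc i) = damping n i * (1 - real i / real (Suc n))" by (simp add: damping_def)
  also have "\<dots> \<le> damping n i * 1" by (intro mult_left_mono damping_nonneg) auto
  finally show ?case using Suc by simp
qed (simp add: damping_def)

lemma damping_tendsto: "(\<lambda>n. damping n i) \<longlonglongrightarrow> 1"
proof -
  have "(\<lambda>n. 1 - real j / real (Suc n)) \<longlonglongrightarrow> 1" for j by real_asymp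
  then have "(\<lambda>n. damping n i) \<longlonglongrightarrow> (\<Prod>j<i. 1)" unfolding damping_def by (intro tendsto_prod)
  then show ?thesis by simp
qed

text \<open>The scale 1/(4N) supplies both the power of 4 in the Bessel coefficients and the power
  of N in the damping factors, so the identity is exact for every n.\<close>

lemma damped_F_eq_laguerre:
  assumes \<nu>: "\<nu> > -1"
  shows "damped_F (damping n) \<nu> t = (- 1) ^ Suc n / Gamma (real (Suc n) + \<nu> + 1) *
     poly (laguerre_monic \<nu> (Suc n)) (t / (4 * real (Suc n)))"
proof -
  have pos: "Gamma (real i + \<nu> + 1) > 0" for i using \<nu> by (intro Gamma_real_pos) linarith
  define N where "N = Suc n"
  define g where "g = Gamma (real N + \<nu> + 1)"
  have g: "g > 0" unfolding g_def by (rule pos)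
  have eq: "damping n i * bessel_coeff \<nu> i * t ^ i =
      (- 1) ^ N / g * (coeff (laguerre_monic \<nu> N) i * (t / (4 * real N)) ^ i)" for i
  proof -
    define h where "h = Gamma (real i + \<nu> + 1)"
    have h: "h > 0" unfolding h_def by (rule pos)
    have "(- 1) ^ N * (- 1) ^ (N + i) = ((- 1) ^ i :: real)" by (simp add: power_add flip: power_mult_distrib)
    then have rhs: "(- 1) ^ N / g * (((- 1) ^ (N + i) * real (N choose i) * g / h) * (t / (4 * real N)) ^ i)
        = (- 1) ^ i * real (N choose i) / h * (t / (4 * real N)) ^ i"
      using g by (simp add: mult.assoc[symmetric])
    have "damping n i * bessel_coeff \<nu> i * t ^ i = (- 1) ^ i * real (N choose i) / h * (t / (4 * real N)) ^ i"
      unfolding damping_eq bessel_coeff_def N_def[symmetric] h_def[symmetric]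
      by (simp add: power_divide power_mult_distrib mult_ac)
    from trans[OF this rhs[symmetric]] show ?thesis
      unfolding coeff_laguerre_monic[OF \<nu>] g_def[symmetric] h_def[symmetric] .
  qed
  have "damped_F (damping n) \<nu> t = (\<Sum>i\<le>N. damping n i * bessel_coeff \<nu> i * t ^ i)"
    unfolding damped_F_def by (intro suminf_finite) (auto simp: damping_eq N_def)
  also have "\<dots> = (- 1) ^ N / g * poly (laguerre_monic \<nu> N) (t / (4 * real N))"
    unfolding eq poly_altdef laguerre_monic_degree(1)[OF \<nu>] by (simp add: sum_distrib_left)
  finally show ?thesis by (simp add: N_def g_def)
qed

lemma damped_F_roots:
  assumes \<nu>: "\<nu> > -1"
  shows "\<exists>S c. finite S \<and> (\<forall>r\<in>S. r > 0) \<and> c \<noteq> 0 \<and> (\<forall>t. damped_F (damping n) \<nu> t = c * (\<Prod>r\<in>S. t - r))"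
proof -
  define q where "q = 4 * real (Suc n)"
  have q: "q > 0" by (simp add: q_def)
  obtain S where S: "finite S" "\<forall>r\<in>S. r > 0" "laguerre_monic \<nu> (Suc n) = (\<Prod>r\<in>S. [:- r, 1:])"
    using laguerre_monic_roots[OF \<nu>] by blast
  define c0 where "c0 = (- 1) ^ Suc n / Gamma (real (Suc n) + \<nu> + 1)"
  have "Gamma (real (Suc n) + \<nu> + 1) > 0" using \<nu> by (intro Gamma_real_pos) linarith
  then have c0: "c0 \<noteq> 0" by (simp add: c0_def)
  have "damped_F (damping n) \<nu> t = c0 / q ^ card S * (\<Prod>r\<in>(*) q ` S. t - r)" for t
  proof -
    have "(\<Prod>r\<in>(*) q ` S. t - r) = (\<Prod>s\<in>S. q * (t / q - s))"
      using q by (subst prod.reindex) (auto simp: inj_on_def algebra_simps)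
    also have "\<dots> = q ^ card S * (\<Prod>s\<in>S. t / q - s)" by (simp add: prod.distrib)
    finally show ?thesis
      unfolding damped_F_eq_laguerre[OF \<nu>] S(3) poly_prod_roots q_def[symmetric] c0_def[symmetric] using q by simp
  qed
  moreover have "finite ((*) q ` S)" "\<forall>r\<in>(*) q ` S. r > 0" "c0 / q ^ card S \<noteq> 0" using S q c0 by auto
  ultimately show ?thesis by blast
qed

lemma damped_F_0: "damped_F m \<nu> 0 = m 0 * bessel_coeff \<nu> 0"
  unfolding damped_F_def by (rule powser_zero)

text \<open>Since F' = -F_{\<nu>+1}/4 and F'' = F_{\<nu>+2}/16, the value of the sum is -(F'/F)' at
  x.\<close>

theorem bessel_Z_has_sum:
  assumes \<nu>: "\<nu> > -1" and x: "x \<ge> 0" "bessel_F \<nu> x \<noteq> 0"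
  shows "((\<lambda>a. 1 / (a - x)\<^sup>2) has_sum
    ((bessel_F (\<nu> + 1) x)\<^sup>2 - bessel_F \<nu> x * bessel_F (\<nu> + 2) x) / (16 * (bessel_F \<nu> x)\<^sup>2)) (bessel_Z \<nu>)"
proof -
  have "\<forall>n. \<exists>S c. finite S \<and> (\<forall>r\<in>S. r > 0) \<and> c \<noteq> 0 \<and> (\<forall>t. damped_F (damping n) \<nu> t = c * (\<Prod>r\<in>S. t - r))"
    using damped_F_roots[OF \<nu>] by blast
  from choice[OF this] obtain S where "\<forall>n. \<exists>c. finite (S n) \<and> (\<forall>r\<in>S n. r > 0) \<and> c \<noteq> 0 \<and>
      (\<forall>t. damped_F (damping n) \<nu> t = c * (\<Prod>r\<in>S n. t - r))" by blast
  from choice[OF this] obtain c where S: "\<And>n. finite (S n)" "\<And>n r. r \<in> S n \<Longrightarrow> r > 0" and c: "\<And>n. c n \<noteq> 0"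
    and prod: "\<And>n t. damped_F (damping n) \<nu> t = c n * (\<Prod>r\<in>S n. t - r)" by blast
  define f1 where "f1 = (\<lambda>t. - bessel_F (\<nu> + 1) t / 4)"
  define f2 where "f2 = (\<lambda>t. bessel_F (\<nu> + 2) t / 16)"
  define G1 where "G1 = (\<lambda>n t. - damped_F (\<lambda>i. damping n (Suc i)) (\<nu> + 1) t / 4)"
  define G2 where "G2 = (\<lambda>n t. damped_F (\<lambda>i. damping n (Suc (Suc i))) (\<nu> + 2) t / 16)"
  \<comment> \<open>Minus the logarithmic derivative at 0, that is, 1/(4(\<nu>+1)). It is the same
    for all n because the multipliers of index 0 and 1 equal 1.\<close>
  define K where "K = bessel_coeff (\<nu> + 1) 0 / (4 * bessel_coeff \<nu> 0)"
  have dG: "(damped_F (damping n) \<nu> has_real_derivative G1 n t) (at t)" for n t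
    unfolding G1_def by (intro damped_F_deriv \<nu> damping_nonneg damping_le_1)
  have dG1: "(G1 n has_real_derivative G2 n t) (at t)" for n t
    using damped_F_deriv[of "\<nu> + 1" "\<lambda>i. damping n (Suc i)" t] \<nu>
    by (auto simp: G1_def G2_def add.assoc damping_nonneg damping_le_1 intro!: derivative_eq_intros)
  have u: "uniform_limit {0..T} (\<lambda>n. damped_F (\<lambda>i. damping n (i + k)) (\<nu> + k)) (bessel_F (\<nu> + k)) sequentially" for T :: real and k :: nat
    using \<nu> by (intro uniform_limit_damped_F damping_nonneg damping_le_1 damping_tendsto) auto
  interpret real_rooted_limit "bessel_F \<nu>" f1 f2 "\<lambda>n. damped_F (damping n) \<nu>" G1 G2 S c K
  proof
    show "(bessel_F \<nu> has_real_derivative f1 t) (at t)" for t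
      unfolding f1_def by (rule bessel_F_deriv[OF \<nu>])
    show "(f1 has_real_derivative f2 t) (at t)" for t
      unfolding f1_def f2_def using \<nu> by (auto intro!: derivative_eq_intros simp: add.assoc)
    show "uniform_limit {0..T} (\<lambda>n. damped_F (damping n) \<nu>) (bessel_F \<nu>) sequentially" for T
      using u[where T = T and k = 0] by simp
    show "uniform_limit {0..T} G1 f1 sequentially" for T
      unfolding G1_def f1_def
      using bounded_linear.uniform_limit[OF bounded_linear_mult_right[of "-(1/4)"], OF u[where T = T and k = 1]] by simp
    show "(\<lambda>n. G2 n t) \<longlonglongrightarrow> f2 t" if "t \<ge> 0" for t
      unfolding G2_def f2_def using tendsto_uniform_limitI[OF u[where T = t and k = 2], of t] that
      by (intro tendsto_divide tendsto_const) auto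
    show "(\<Sum>r\<in>S n. 1 / r) \<le> K" for n
    proof -
      have "0 \<notin> S n" using S(2)[of 0 n] by auto
      from log_deriv_prod(1)[OF S(1) prod dG dG1 this]
      have "G1 n 0 = - damped_F (damping n) \<nu> 0 * (\<Sum>r\<in>S n. 1 / r)"
        by (simp add: sum_negf)
      moreover have "G1 n 0 = - bessel_coeff (\<nu> + 1) 0 / 4" "damped_F (damping n) \<nu> 0 = bessel_coeff \<nu> 0"
        by (simp_all add: G1_def damped_F_0 damping_def)
      moreover have "bessel_coeff \<nu> 0 > 0" using bessel_F_0_pos[OF \<nu>] by (simp add: bessel_F_def)
      ultimately show ?thesis by (simp add: K_def field_simps)
    qed
    show "bessel_F \<nu> 0 \<noteq> 0" using bessel_F_0_pos[OF \<nu>] by simp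
    show "f1 a \<noteq> 0" if "a > 0" "bessel_F \<nu> a = 0" for a
      using bessel_F_zeros_simple[OF \<nu> that] by (simp add: f1_def)
    show "finite {a. 0 < a \<and> a \<le> X \<and> bessel_F \<nu> a = 0}" for X
      using finite_bessel_Z[OF \<nu>, of X] by (auto simp: bessel_Z_def conj_ac elim: back_subst[of finite])
  qed (use S c prod dG dG1 in auto)
  have "D x = ((f1 x)\<^sup>2 - bessel_F \<nu> x * f2 x) / (bessel_F \<nu> x)\<^sup>2" by (rule D_def)
  also have "\<dots> = (((bessel_F (\<nu> + 1) x)\<^sup>2 - bessel_F \<nu> x * bessel_F (\<nu> + 2) x) / 16) / (bessel_F \<nu> x)\<^sup>2"
    by (simp add: f1_def f2_def power_divide diff_divide_distrib)
  also have "\<dots> = ((bessel_F (\<nu> + 1) x)\<^sup>2 - bessel_F \<nu> x * bessel_F (\<nu> + 2) x) / (16 * (bessel_F \<nu> x)\<^sup>2)"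
    by simp
  finally have "D x = ((bessel_F (\<nu> + 1) x)\<^sup>2 - bessel_F \<nu> x * bessel_F (\<nu> + 2) x) / (16 * (bessel_F \<nu> x)\<^sup>2)" .
  with has_sum_zeros[OF x] show ?thesis by (simp add: bessel_Z_def)
qed

text \<open>Completing the square in the Riccati equation of \<open>F'/F\<close> gives \<open>x \<Sum>1/(a - x)\<^sup>2 \<ge> 1/4 - (\<nu> + 1)\<^sup>2/(4x)\<close>,
  which is impossible for large \<open>x\<close> if the sum has finitely many terms.\<close>
lemma infinite_bessel_Z:
  assumes \<nu>: "\<nu> > -1"
  shows "infinite (bessel_Z \<nu>)"
proof
  assume fin: "finite (bessel_Z \<nu>)"
  define s where "s = (\<lambda>x. \<Sum>a\<in>bessel_Z \<nu>. x * (1 / (a - x)\<^sup>2))"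
  have "((\<lambda>x. x * (1 / (a - x)\<^sup>2)) \<longlongrightarrow> 0) at_top" for a :: real by real_asymp
  then have "((\<lambda>x. s x + (\<nu> + 1)\<^sup>2 / (4 * x)) \<longlongrightarrow> (\<Sum>a\<in>bessel_Z \<nu>. 0) + 0) at_top"
    unfolding s_def by (intro tendsto_intros) (auto, real_asymp)
  then have lim: "((\<lambda>x. s x + (\<nu> + 1)\<^sup>2 / (4 * x)) \<longlongrightarrow> 0) at_top" by simp
  have bound: "1 / 4 \<le> s x + (\<nu> + 1)\<^sup>2 / (4 * x)" if x: "x > 0" "\<forall>a\<in>bessel_Z \<nu>. a < x" for x
  proof -
    define F F1 F2 where "F = bessel_F \<nu> x" and "F1 = bessel_F (\<nu> + 1) x" and "F2 = bessel_F (\<nu> + 2) x"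
    have F: "F \<noteq> 0" using x by (force simp: F_def bessel_Z_def)
    have F2: "x * F2 = 4 * ((\<nu> + 1) * F1 - F)"
      using bessel_F_recurrence[OF \<nu>, of x] by (simp add: F_def F1_def F2_def)
    define b where "b = F1 / F"
    have "(\<Sum>a\<in>bessel_Z \<nu>. 1 / (a - x)\<^sup>2) = (F1\<^sup>2 - F * F2) / (16 * F\<^sup>2)"
      using bessel_Z_has_sum[OF \<nu>, of x] x F fin
      by (intro has_sum_unique[OF has_sum_finite[OF fin]]) (auto simp: F_def F1_def F2_def)
    moreover have "s x = x * (\<Sum>a\<in>bessel_Z \<nu>. 1 / (a - x)\<^sup>2)"
      unfolding s_def by (rule sum_distrib_left[symmetric])
    ultimately have "s x = x * ((F1\<^sup>2 - F * F2) / (16 * F\<^sup>2))"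
      by simp
    also have "\<dots> = (x * F1\<^sup>2 - F * (x * F2)) / (16 * F\<^sup>2)" by (simp add: algebra_simps)
    also have "\<dots> = x * b\<^sup>2 / 16 - (\<nu> + 1) * b / 4 + 1 / 4"
      unfolding F2 b_def using F by (simp add: field_simps power2_eq_square)
    also have "\<dots> = x / 16 * (b - 2 * (\<nu> + 1) / x)\<^sup>2 - (\<nu> + 1)\<^sup>2 / (4 * x) + 1 / 4"
      using x by (simp add: field_simps power2_eq_square)
    finally have "s x + (\<nu> + 1)\<^sup>2 / (4 * x) = 1 / 4 + x / 16 * (b - 2 * (\<nu> + 1) / x)\<^sup>2" by simp
    then show ?thesis using x by simp
  qed
  have "eventually (\<lambda>x. \<forall>a\<in>bessel_Z \<nu>. a < x) at_top"
    using fin by (intro eventually_ball_finite) (auto intro: eventually_gt_at_top)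
  then have "eventually (\<lambda>x. 1 / 4 \<le> s x + (\<nu> + 1)\<^sup>2 / (4 * x)) at_top"
    using eventually_gt_at_top[of 0] by eventually_elim (use bound in blast)
  from tendsto_lowerbound[OF lim this] show False by simp
qed

text \<open>Through this bijection sums over m become sums over the set of zeros. It rests on both
  discreteness and infinitude of the zeros, which make the description of the m-th zero unique and
  satisfiable for every m \<ge> 1.\<close>

lemma bij_betw_bessel_zero:
  assumes \<nu>: "\<nu> > -1"
  shows "bij_betw (\<lambda>m. (bessel_zero \<nu> (Suc m))\<^sup>2) UNIV (bessel_Z \<nu>)"
    and "n \<ge> 1 \<Longrightarrow> bessel_zero \<nu> n > 0 \<and> (bessel_zero \<nu> n)\<^sup>2 \<in> bessel_Z \<nu>"
proof -
  define T where "T = {t. t > 0 \<and> bessel_J \<nu> t = 0}"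
  have TZ: "t \<in> T \<longleftrightarrow> t > 0 \<and> t\<^sup>2 \<in> bessel_Z \<nu>" for t
    using bessel_J_eq[OF \<nu>, of t] by (auto simp: T_def bessel_Z_def)
  have sq: "bij_betw (\<lambda>t. t\<^sup>2) T (bessel_Z \<nu>)"
    by (rule bij_betwI[of _ _ _ sqrt]) (auto simp: TZ bessel_Z_def)
  have "infinite T" using infinite_bessel_Z[OF \<nu>] bij_betw_finite[OF sq] by simp
  moreover have "finite {t \<in> T. t \<le> x}" for x
  proof (rule finite_imageD)
    have "(\<lambda>t. t\<^sup>2) ` {t \<in> T. t \<le> x} \<subseteq> {a \<in> bessel_Z \<nu>. a \<le> x\<^sup>2}"
      by (auto simp: TZ intro!: power_mono)
    then show "finite ((\<lambda>t. t\<^sup>2) ` {t \<in> T. t \<le> x})"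
      by (rule finite_subset) (rule finite_bessel_Z[OF \<nu>])
    show "inj_on (\<lambda>t. t\<^sup>2) {t \<in> T. t \<le> x}"
      by (rule inj_on_subset[OF bij_betw_imp_inj_on[OF sq]]) auto
  qed
  ultimately have c: "bij_betw (\<lambda>x. card {t \<in> T. t \<le> x}) T {1..}" by (rule bij_betw_card_le)
  \<comment> \<open>The definite description behind \<open>bessel_zero\<close> is literally the
    inverse of the rank function.\<close>
  have bz: "bessel_zero \<nu> m = the_inv_into T (\<lambda>x. card {t \<in> T. t \<le> x}) m" for m
    unfolding bessel_zero_def the_inv_into_def T_def
    by (intro arg_cong[of _ _ The] ext) (auto intro!: arg_cong[of _ _ card])
  have "bij_betw (bessel_zero \<nu>) {1..} T"
    using bij_betw_the_inv_into[OF c] by (simp add: bz[abs_def])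
  moreover have "bij_betw Suc UNIV {1..}"
    by (rule bij_betwI[of _ _ _ "\<lambda>n. n - 1"]) auto
  ultimately have b: "bij_betw (bessel_zero \<nu> \<circ> Suc) UNIV T" by (rule bij_betw_trans[rotated])
  from bij_betw_trans[OF this sq] show "bij_betw (\<lambda>m. (bessel_zero \<nu> (Suc m))\<^sup>2) UNIV (bessel_Z \<nu>)"
    by (simp add: o_def)
  assume "n \<ge> 1"
  then have "bessel_zero \<nu> n \<in> T"
    using \<open>bij_betw (bessel_zero \<nu>) {1..} T\<close> by (auto dest: bij_betwE)
  then show "bessel_zero \<nu> n > 0 \<and> (bessel_zero \<nu> n)\<^sup>2 \<in> bessel_Z \<nu>" by (simp add: TZ)
qed

section \<open>The polynomials \<open>R\<^sub>k\<close>\<close>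

text \<open>\<open>alpha_num k\<close> represents (2y)^k times the k-th derivative of A at a zero y
  of A; the recursion is the k-th derivative of the Riccati equation times (2y)^k. The last summand
  comes from differentiating the factor x in x A^2 once; its coefficient 2k is 0 where
  \<open>k - 1\<close> is truncated.\<close>

function alpha_num :: "nat \<Rightarrow> real poly poly" where
  "alpha_num 0 = 0"
| "alpha_num (Suc k) =
     (if k = 0 then -1 else 0) + [:[:- 2 * real k, 2:]:] * alpha_num k
     - [:0, 1:] * (\<Sum>i\<le>k. of_nat (k choose i) * (alpha_num i * alpha_num (k - i)))
     - [:0, of_nat (2 * k):] * (\<Sum>i\<le>k - 1. of_nat ((k - 1) choose i) * (alpha_num i * alpha_num (k - 1 - i)))"
  by pat_completeness auto
termination by (relation "Wellfounded.measure id") auto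

declare alpha_num.simps(2) [simp del]

text \<open>Substituting the constant polynomial y first turns both evaluations into
  \<open>poly\<close>, whose rules for sums and products then apply.\<close>

lemma poly2_altdef: "poly2 R p y = poly (poly R [:y:]) p"
  unfolding poly2_def by (induction R) (simp_all add: map_poly_pCons)

lemma coeff_mult_degree_le:
  assumes "degree p \<le> a" "degree q \<le> b"
  shows "coeff (p * q) (a + b) = coeff p a * coeff q b"
proof (cases "degree p = a \<and> degree q = b")
  case False
  with assms have "degree p + degree q < a + b" by linarith
  then have "degree (p * q) < a + b" using degree_mult_le[of p q] by linarith
  moreover have "coeff p a = 0 \<or> coeff q b = 0" using False assms by (auto simp: coeff_eq_0)
  ultimately show ?thesis by (auto simp: coeff_eq_0)
qed (auto simp: coeff_mult_degree_sum)

text \<open>Signs of elements of \<^typ>\<open>real poly\<close> refer to the library's order on polynomials,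
  in which \<open>q < 0\<close> means that the leading coefficient of \<open>q\<close> is negative.\<close>

lemma alpha_num_degree_sign:
  assumes "k \<ge> 1"
  shows "degree (alpha_num k) \<le> (k - 1) div 2 \<and> coeff (alpha_num k) ((k - 1) div 2) < 0"
  using assms
proof (induction k rule: less_induct)
  case (less k)
  define d where "d = (\<lambda>i::nat. (i - 1) div 2)"
  have IH: "degree (alpha_num i) \<le> d i" "i \<ge> 1 \<Longrightarrow> coeff (alpha_num i) (d i) < 0" if "i < k" for i
    using less.IH[of i] that by (cases "i = 0"; auto simp: d_def)+
  show ?case
  proof (cases "k = 1")
    case True
    then show ?thesis by (simp add: alpha_num.simps(2))
  next
    case False
    with less.prems obtain m where k: "k = Suc m" "m \<ge> 1" by (cases k) auto
    define D where "D = m div 2"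
    define T1 where "T1 = [:[:- 2 * real m, 2:]:] * alpha_num m"
    define S2 where "S2 = (\<Sum>i\<le>m. of_nat (m choose i) * (alpha_num i * alpha_num (m - i)))"
    define S3 where "S3 = (\<Sum>i\<le>m - 1. of_nat ((m - 1) choose i) * (alpha_num i * alpha_num (m - 1 - i)))"
    have ak: "alpha_num k = T1 - [:0, 1:] * S2 - [:0, of_nat (2 * m):] * S3"
      using k by (simp add: alpha_num.simps(2) T1_def S2_def S3_def)
    have coeff_scalar: "coeff (of_nat c * q) j = of_nat c * coeff q j" for c j and q :: "real poly poly"
      by (simp add: of_nat_poly)
    have nonpos: "coeff (alpha_num i) j \<le> 0" if "i < k" "j \<ge> d i" for i j
    proof (cases "i = 0")
      case False
      with IH[OF that(1)] that(2) show ?thesis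
        by (cases "j = d i") (auto simp: coeff_eq_0 less_imp_le)
    qed auto
    have prod: "degree (alpha_num i * alpha_num j) \<le> d i + d j \<and>
        coeff (alpha_num i * alpha_num j) (d i + d j) \<ge> 0" if "i < k" "j < k" for i j
    proof
      show "degree (alpha_num i * alpha_num j) \<le> d i + d j"
        using degree_mult_le[of "alpha_num i" "alpha_num j"] IH(1)[OF that(1)] IH(1)[OF that(2)] by linarith
      have "coeff (alpha_num i * alpha_num j) (d i + d j) = coeff (alpha_num i) (d i) * coeff (alpha_num j) (d j)"
        using IH(1)[OF that(1)] IH(1)[OF that(2)] by (simp add: coeff_mult_degree_le)
      then show "coeff (alpha_num i * alpha_num j) (d i + d j) \<ge> 0"
        using nonpos[OF that(1)] nonpos[OF that(2)] by (simp add: mult_nonpos_nonpos)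
    qed
    \<comment> \<open>Index 0 contributes nothing as \<open>alpha_num 0 = 0\<close>; otherwise d i +
      d j + 1 \<le> D. So at degree D - 1 the coefficient is nonnegative, and above it is zero; the
      factor y in the recursion shifts this to D.\<close>
    have trm: "coeff (alpha_num i * alpha_num j) l \<ge> 0 \<and> (l \<ge> D \<longrightarrow> coeff (alpha_num i * alpha_num j) l = 0)"
      if "i + j = m \<or> i + j = m - 1" "Suc l \<ge> D" for i j l
    proof (cases "i = 0 \<or> j = 0")
      case False
      have ij: "i < k" "j < k" using that k False by auto
      obtain i' j' where ij': "i = Suc i'" "j = Suc j'" using False by (metis not0_implies_Suc)
      have "i' div 2 + j' div 2 \<le> (i' + j') div 2" by (metis div_add1_eq le_add1)
      moreover have "(i' + j' + 2) div 2 \<le> D"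
        unfolding D_def using that(1) ij' by (intro div_le_mono) auto
      ultimately have "Suc (d i + d j) \<le> D" unfolding d_def ij' by simp
      then have "d i + d j \<le> l" "l \<ge> D \<Longrightarrow> d i + d j < l" using that(2) by auto
      then show ?thesis
        using prod[OF ij] by (cases "l = d i + d j") (auto simp: coeff_eq_0)
    qed auto
    have S2: "coeff S2 l \<ge> 0 \<and> (l \<ge> D \<longrightarrow> coeff S2 l = 0)" if "Suc l \<ge> D" for l
      unfolding S2_def using that trm
      by (auto simp: coeff_sum coeff_scalar intro!: sum_nonneg mult_nonneg_nonneg sum.neutral)
    have trm3: "coeff (alpha_num i * alpha_num (m - Suc i)) l \<ge> 0 \<and>
        (l \<ge> D \<longrightarrow> coeff (alpha_num i * alpha_num (m - Suc i)) l = 0)" if "i \<le> m - Suc 0" "Suc l \<ge> D" for i l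
      using trm[of i "m - Suc i" l] that k by simp
    have S3: "coeff S3 l \<ge> 0 \<and> (l \<ge> D \<longrightarrow> coeff S3 l = 0)" if "Suc l \<ge> D" for l
      unfolding S3_def using that trm3
      by (auto simp: coeff_sum coeff_scalar intro!: sum_nonneg mult_nonneg_nonneg sum.neutral)
    have T1: "coeff T1 j = [:- 2 * real m, 2:] * coeff (alpha_num m) j" for j
      by (simp add: T1_def)
    have dm: "d m \<le> D" "odd m \<Longrightarrow> d m = D" by (auto simp: d_def D_def elim!: oddE)
    have c: "coeff (alpha_num k) j = coeff T1 j - (case j of 0 \<Rightarrow> 0 | Suc l \<Rightarrow> coeff S2 l)
        - of_nat (2 * m) * (case j of 0 \<Rightarrow> 0 | Suc l \<Rightarrow> coeff S3 l)" for j
      by (simp add: ak coeff_pCons split: nat.split)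
    \<comment> \<open>2p - 2m may be negative at a given p, but its leading coefficient 2 makes it
      positive in the order on polynomials.\<close>
    have lin_pos: "[:- 2 * real m, 2:] > 0" by (simp add: less_poly_def pos_poly_pCons)
    have "degree (alpha_num k) \<le> D"
    proof (rule degree_le, intro allI impI)
      fix j assume "D < j"
      then have "coeff (alpha_num m) j = 0" using IH(1)[of m] k dm by (intro coeff_eq_0) auto
      then show "coeff (alpha_num k) j = 0"
        using \<open>D < j\<close> S2 S3 by (cases j) (auto simp: c T1)
    qed
    moreover have "coeff (alpha_num k) D < 0"
    proof -
      have t1: "coeff T1 D \<le> 0"
        using lin_pos nonpos[of m D] dm k unfolding T1 by (intro mult_nonneg_nonpos) auto
      have t2: "(case D of 0 \<Rightarrow> 0 | Suc l \<Rightarrow> coeff S2 l) \<ge> 0"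
        using S2 by (auto split: nat.split)
      have t3: "of_nat (2 * m) * (case D of 0 \<Rightarrow> 0 | Suc l \<Rightarrow> coeff S3 l) \<ge> 0"
        using S3 by (auto split: nat.split intro!: mult_nonneg_nonneg)
      show ?thesis
      \<comment> \<open>For odd m, d m = D and the linear term is strictly negative at degree D. For
        even m, d m = D - 1; strictness then comes from the summand i = 1 of \<open>S2\<close>,
        whose degree d 1 + d (m - 1) = D - 1 is the largest possible.\<close>
      proof (cases "odd m")
        case True
        have "coeff T1 D < 0"
          using lin_pos IH(2)[of m] dm(2)[OF True] k unfolding T1 by (intro mult_pos_neg) auto
        with t2 t3 show ?thesis unfolding c by (simp add: algebra_simps add_pos_nonneg)
      next
        case False
        with k obtain l where l: "D = Suc l" "m = 2 * Suc l" unfolding D_def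
          by (metis dvd_mult_div_cancel even_Suc even_zero mult_0_right not0_implies_Suc not_one_le_zero)
        have d1: "d 1 = 0" and dm1: "d (m - 1) = l" using l by (auto simp: d_def)
        have "coeff (alpha_num 1 * alpha_num (m - 1)) l =
            coeff (alpha_num 1) (d 1) * coeff (alpha_num (m - 1)) (d (m - 1))"
          using coeff_mult_degree_le[of "alpha_num 1" "d 1" "alpha_num (m - 1)" "d (m - 1)"]
            IH(1)[of 1] IH(1)[of "m - 1"] k d1 dm1 by simp
        also have "\<dots> > 0" using IH(2)[of 1] IH(2)[of "m - 1"] k l by (intro mult_neg_neg) auto
        finally have "0 < coeff (of_nat (m choose 1) * (alpha_num 1 * alpha_num (m - 1))) l"
          unfolding coeff_scalar using k by (intro mult_pos_pos) auto
        moreover have "coeff S2 l = (\<Sum>i\<le>m. coeff (of_nat (m choose i) * (alpha_num i * alpha_num (m - i))) l)"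
          by (simp add: S2_def coeff_sum)
        moreover have "(\<Sum>i\<le>m. coeff (of_nat (m choose i) * (alpha_num i * alpha_num (m - i))) l) > 0"
        proof (rule sum_pos2[of _ 1])
          show "0 \<le> coeff (of_nat (m choose i) * (alpha_num i * alpha_num (m - i))) l" if "i \<in> {..m}" for i
            using trm[of i "m - i" l] that l(1) unfolding coeff_scalar by (intro mult_nonneg_nonneg) auto
        qed (use calculation k in auto)
        ultimately have "coeff S2 l > 0" by linarith
        with t1 t3 l show ?thesis unfolding c by (simp add: algebra_simps add_pos_nonneg)
      qed
    qed
    ultimately show ?thesis using k by (simp add: D_def)
  qed
qed

section \<open>The Riccati equation and its derivatives\<close>

lemma DERIV_transform_nhds:
  fixes f g :: "real \<Rightarrow> real"
  assumes "(g has_real_derivative D) (at x)" "eventually (\<lambda>t. f t = g t) (nhds x)"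
  shows "(f has_real_derivative D) (at x)"
  using assms DERIV_cong_ev[OF refl assms(2) refl, of D] by simp

lemma bessel_quot_eq:
  assumes "p > -1" "x > 0"
  shows "bessel_quot p x = 2 * bessel_F p x / (x * bessel_F (p + 1) x)"
proof -
  define s where "s = sqrt x"
  have s: "s > 0" "x = s\<^sup>2" using assms by (auto simp: s_def)
  have pw: "(s / 2) powr (p + 1) = (s / 2) powr p * (s / 2)" "(s / 2) powr p > 0" using s by (simp_all add: powr_add)
  then show ?thesis
    unfolding bessel_quot_def s_def[symmetric] using assms s
    by (simp only: bessel_J_eq pw(1)) (simp add: power2_eq_square mult_ac)
qed

text \<open>The positive points at which A has no pole. Being open, the set allows local identities
  to be differentiated; it contains the zeros of A because zeros of \<open>bessel_F p\<close> are
  simple.\<close>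

definition quot_domain :: "real \<Rightarrow> real set" where
  "quot_domain p = {x. x > 0 \<and> bessel_F (p + 1) x \<noteq> 0}"

lemma open_quot_domain:
  assumes "p > -1"
  shows "open (quot_domain p)"
proof -
  have "open {x. bessel_F (p + 1) x \<noteq> 0}"
    using continuous_on_bessel_F[of "p + 1" UNIV] assms by (intro open_Collect_neq) auto
  then show ?thesis
    unfolding quot_domain_def by (intro open_Collect_conj) (auto intro: open_Collect_less continuous_intros)
qed

text \<open>Two computations of one derivative. Eliminating F_{p+2} from the quotient rule gives the
  Riccati equation for the Taylor coefficients; eliminating F_p from A gives 2(p+1)/x - F_{p+2}/(2
  F_{p+1}), whose derivative is the partial fraction sum.\<close>

lemma quot_deriv:
  assumes p: "p > -1" and x: "x \<in> quot_domain p"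
  defines "A \<equiv> bessel_quot p x"
  shows "(bessel_quot p has_real_derivative (- 1 - x * A\<^sup>2 + 2 * p * A) / (2 * x)) (at x)"
    and "(bessel_quot p has_real_derivative - 2 * (p + 1) / x\<^sup>2 -
       2 * (((bessel_F (p + 2) x)\<^sup>2 - bessel_F (p + 1) x * bessel_F (p + 3) x) / (16 * (bessel_F (p + 1) x)\<^sup>2))) (at x)"
proof -
  define F F1 F2 F3 where "F = bessel_F p x" and "F1 = bessel_F (p + 1) x"
    and "F2 = bessel_F (p + 2) x" and "F3 = bessel_F (p + 3) x"
  have x0: "x > 0" and F1: "F1 \<noteq> 0" using x by (auto simp: quot_domain_def F1_def)
  have ev: "eventually (\<lambda>t. t \<in> quot_domain p) (nhds x)"
    using open_quot_domain[OF p] x by (rule eventually_nhds_in_open)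
  have rec: "t / 4 * bessel_F (p + 2) t = (p + 1) * bessel_F (p + 1) t - bessel_F p t" for t
    using bessel_F_recurrence[OF p, of t] by simp
  have A: "A = 2 * F / (x * F1)" unfolding A_def F_def F1_def using bessel_quot_eq[OF p x0] .
  have "((\<lambda>t. 2 * bessel_F p t / (t * bessel_F (p + 1) t)) has_real_derivative
      (2 * (- F1 / 4) * (x * F1) - 2 * F * (F1 + x * (- F2 / 4))) / ((x * F1) * (x * F1))) (at x)"
    using p x0 F1 by (auto intro!: derivative_eq_intros simp: F_def F1_def F2_def add.assoc)
  moreover have "eventually (\<lambda>t. bessel_quot p t = 2 * bessel_F p t / (t * bessel_F (p + 1) t)) (nhds x)"
    using ev by eventually_elim (auto simp: quot_domain_def bessel_quot_eq[OF p])
  ultimately have "(bessel_quot p has_real_derivative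
      (2 * (- F1 / 4) * (x * F1) - 2 * F * (F1 + x * (- F2 / 4))) / ((x * F1) * (x * F1))) (at x)"
    by (rule DERIV_transform_nhds)
  moreover have "(2 * (- F1 / 4) * (x * F1) - 2 * F * (F1 + x * (- F2 / 4))) / ((x * F1) * (x * F1))
     = (- 1 - x * A\<^sup>2 + 2 * p * A) / (2 * x)"
  proof -
    have "x * (- F2 / 4) = - (x / 4 * F2)" by simp
    also have "\<dots> = F - (p + 1) * F1" unfolding F2_def rec by (simp add: F_def F1_def)
    finally have q: "x * (- F2 / 4) = F - (p + 1) * F1" .
    show ?thesis unfolding q A using x0 F1 by (simp add: field_simps power2_eq_square)
  qed
  ultimately show "(bessel_quot p has_real_derivative (- 1 - x * A\<^sup>2 + 2 * p * A) / (2 * x)) (at x)" by simp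
  define C where "C = 2 * (p + 1)"
  have "((\<lambda>t. C / t - bessel_F (p + 2) t / (2 * bessel_F (p + 1) t)) has_real_derivative
      - (C / x\<^sup>2) - ((- F3 / 4) * (2 * F1) - F2 * (2 * (- F2 / 4))) / ((2 * F1) * (2 * F1))) (at x)"
    using p x0 F1 by (auto intro!: derivative_eq_intros simp: F3_def F1_def F2_def add.assoc power2_eq_square)
  moreover have "eventually (\<lambda>t. bessel_quot p t = C / t - bessel_F (p + 2) t / (2 * bessel_F (p + 1) t)) (nhds x)"
    using ev
  proof eventually_elim
    case (elim t)
    then have t: "t > 0" "bessel_F (p + 1) t \<noteq> 0" by (auto simp: quot_domain_def)
    have "bessel_quot p t = 2 * ((p + 1) * bessel_F (p + 1) t - t / 4 * bessel_F (p + 2) t) / (t * bessel_F (p + 1) t)"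
      unfolding bessel_quot_eq[OF p t(1)] rec by simp
    also have "\<dots> = C / t - bessel_F (p + 2) t / (2 * bessel_F (p + 1) t)"
      using t by (simp add: C_def field_simps)
    finally show ?case .
  qed
  ultimately have "(bessel_quot p has_real_derivative
      - (C / x\<^sup>2) - ((- F3 / 4) * (2 * F1) - F2 * (2 * (- F2 / 4))) / ((2 * F1) * (2 * F1))) (at x)"
    by (rule DERIV_transform_nhds)
  moreover have "((- F3 / 4) * (2 * F1) - F2 * (2 * (- F2 / 4))) / ((2 * F1) * (2 * F1)) = 2 * ((F2\<^sup>2 - F1 * F3) / (16 * F1\<^sup>2))"
    using F1 by (simp add: field_simps power2_eq_square)
  moreover have "- (C / x\<^sup>2) = - 2 * (p + 1) / x\<^sup>2" by (simp only: C_def minus_divide_left mult_minus_left)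
  ultimately show "(bessel_quot p has_real_derivative - 2 * (p + 1) / x\<^sup>2 -
       2 * (((bessel_F (p + 2) x)\<^sup>2 - bessel_F (p + 1) x * bessel_F (p + 3) x) / (16 * (bessel_F (p + 1) x)\<^sup>2))) (at x)"
    by (simp add: F1_def F2_def F3_def)
qed

section \<open>Leibniz rule for the square and higher derivatives of the quotient\<close>

lemma sum_binomial_Leibniz:
  fixes e :: "nat \<Rightarrow> real"
  shows "(\<Sum>i\<le>Suc k. real (Suc k choose i) * (e i * e (Suc k - i))) =
    (\<Sum>i\<le>k. real (k choose i) * (e (Suc i) * e (k - i) + e i * e (Suc (k - i))))"
proof -
  have "(\<Sum>i\<le>Suc k. real (Suc k choose i) * (e i * e (Suc k - i))) =
      e 0 * e (Suc k) + (\<Sum>i\<le>k. real (Suc k choose Suc i) * (e (Suc i) * e (k - i)))"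
    by (subst sum.atMost_Suc_shift) simp
  also have "(\<Sum>i\<le>k. real (Suc k choose Suc i) * (e (Suc i) * e (k - i))) =
      (\<Sum>i\<le>k. real (k choose i) * (e (Suc i) * e (k - i))) + (\<Sum>i\<le>k. real (k choose Suc i) * (e (Suc i) * e (k - i)))"
    by (simp add: sum.distrib[symmetric] algebra_simps)
  also have "e 0 * e (Suc k) + (\<dots>) = (\<Sum>i\<le>k. real (k choose i) * (e (Suc i) * e (k - i))) +
      (\<Sum>i\<le>Suc k. real (k choose i) * (e i * e (Suc k - i)))"
  proof -
    have "(\<Sum>i\<le>Suc k. real (k choose i) * (e i * e (Suc k - i))) =
        e 0 * e (Suc k) + (\<Sum>i\<le>k. real (k choose Suc i) * (e (Suc i) * e (k - i)))"
      by (subst sum.atMost_Suc_shift) simp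
    then show ?thesis by simp
  qed
  also have "(\<Sum>i\<le>Suc k. real (k choose i) * (e i * e (Suc k - i))) = (\<Sum>i\<le>k. real (k choose i) * (e i * e (Suc (k - i))))"
    unfolding sum.atMost_Suc by (simp add: binomial_eq_0) (intro sum.cong, auto simp: Suc_diff_le)
  finally show ?thesis by (simp add: sum.distrib[symmetric] algebra_simps)
qed

text \<open>The k-th derivative of A^2 when \<open>d i\<close> is the i-th derivative of A.\<close>

definition leibniz_square :: "(nat \<Rightarrow> real \<Rightarrow> real) \<Rightarrow> nat \<Rightarrow> real \<Rightarrow> real" where
  "leibniz_square d k x = (\<Sum>i\<le>k. real (k choose i) * (d i x * d (k - i) x))"

lemma leibniz_square_deriv:
  assumes "\<And>i. i \<le> k \<Longrightarrow> (d i has_real_derivative d (Suc i) x) (at x)"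
  shows "(leibniz_square d k has_real_derivative leibniz_square d (Suc k) x) (at x)"
proof -
  have "((\<lambda>x. \<Sum>i\<le>k. real (k choose i) * (d i x * d (k - i) x)) has_real_derivative
      (\<Sum>i\<le>k. real (k choose i) * (d (Suc i) x * d (k - i) x + d (Suc (k - i)) x * d i x))) (at x)"
    by (intro DERIV_sum DERIV_cmult DERIV_mult assms) auto
  also have "(\<Sum>i\<le>k. real (k choose i) * (d (Suc i) x * d (k - i) x + d (Suc (k - i)) x * d i x)) = leibniz_square d (Suc k) x"
    unfolding leibniz_square_def sum_binomial_Leibniz[of k "\<lambda>i. d i x"] by (simp add: mult.commute)
  finally show ?thesis by (simp add: leibniz_square_def[abs_def])
qed

text \<open>\<open>deriv\<close> is total, so differentiability needs proof. The identity for k - 1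
  expresses \<open>d k\<close> near x by lower derivatives; this yields the differentiability of
  \<open>d k\<close> and, differentiated, the identity for k. Hence both claims go through one
  induction.\<close>

lemma higher_deriv_quot:
  fixes p :: real
  assumes p: "p > -1"
  defines "d \<equiv> \<lambda>k. (deriv ^^ k) (bessel_quot p)"
  assumes "x \<in> quot_domain p"
  shows "(d k has_real_derivative d (Suc k) x) (at x)"
    and "2 * x * d (Suc k) x = (if k = 0 then -1 else 0) - x * leibniz_square d k x
       - real k * leibniz_square d (k - 1) x + 2 * (p - real k) * d k x"
proof -
  define rhs where "rhs = (\<lambda>k x. (if k = 0 then -1 else 0) - x * leibniz_square d k x
       - real k * leibniz_square d (k - 1) x + 2 * (p - real k) * d k x)"
  have d_Suc: "d (Suc k) x = deriv (d k) x" for k x by (simp add: d_def)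
  have "\<forall>x\<in>quot_domain p. (d k has_real_derivative d (Suc k) x) (at x) \<and> 2 * x * d (Suc k) x = rhs k x"
  proof (induction k rule: less_induct)
    case (less k)
    show ?case
    proof
      fix x assume x: "x \<in> quot_domain p"
      then have x0: "x > 0" by (simp add: quot_domain_def)
      show "(d k has_real_derivative d (Suc k) x) (at x) \<and> 2 * x * d (Suc k) x = rhs k x"
      proof (cases k)
        case 0
        have der: "(d 0 has_real_derivative (- 1 - x * (d 0 x)\<^sup>2 + 2 * p * d 0 x) / (2 * x)) (at x)"
          using quot_deriv(1)[OF p x] by (simp add: d_def)
        then have "d 1 x = (- 1 - x * (d 0 x)\<^sup>2 + 2 * p * d 0 x) / (2 * x)"
          using DERIV_imp_deriv[OF der] by (simp add: d_def)
        then show ?thesis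
          using der x0 0 by (simp add: rhs_def leibniz_square_def power2_eq_square)
      next
        case (Suc m)
        have der: "(d i has_real_derivative d (Suc i) x) (at x)" if "i \<le> m" for i
          using less.IH[of i] that Suc x by simp
        \<comment> \<open>The case m = 0 is separate because \<open>m - 1\<close> is truncated
          there; the factor \<open>real m\<close> is then zero.\<close>
        have lower: "((\<lambda>t. real m * leibniz_square d (m - 1) t) has_real_derivative real m * leibniz_square d m x) (at x)"
        proof (cases m)
          case (Suc l)
          then show ?thesis using der
            by (auto intro!: DERIV_cmult leibniz_square_deriv simp del: of_nat_Suc)
        qed simp
        have r: "(rhs m has_real_derivative 0 - (1 * leibniz_square d m x + leibniz_square d (Suc m) x * x)
            - real m * leibniz_square d m x + 2 * (p - real m) * d (Suc m) x) (at x)"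
          unfolding rhs_def
          by (rule DERIV_add[OF DERIV_diff[OF DERIV_diff[OF DERIV_const
                DERIV_mult[OF DERIV_ident leibniz_square_deriv[of m d x, OF der]]] lower] DERIV_cmult[OF der[OF order_refl]]])
        define E where "E = 0 - (1 * leibniz_square d m x + leibniz_square d (Suc m) x * x)
            - real m * leibniz_square d m x + 2 * (p - real m) * d (Suc m) x"
        have "((\<lambda>t. rhs m t / (2 * t)) has_real_derivative (E * (2 * x) - rhs m x * 2) / ((2 * x) * (2 * x))) (at x)"
          using r x0 unfolding E_def[symmetric] by (auto intro!: derivative_eq_intros)
        moreover have "eventually (\<lambda>t. d k t = rhs m t / (2 * t)) (nhds x)"
          using eventually_nhds_in_open[OF open_quot_domain[OF p] x]
        proof eventually_elim
          case (elim t)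
          with less.IH[of m] Suc have "2 * t * d k t = rhs m t" by simp
          moreover have "t > 0" using elim by (simp add: quot_domain_def)
          ultimately show ?case by (simp add: field_simps)
        qed
        ultimately have dk: "(d k has_real_derivative (E * (2 * x) - rhs m x * 2) / ((2 * x) * (2 * x))) (at x)"
          by (rule DERIV_transform_nhds)
        then have eq: "d (Suc k) x = (E * (2 * x) - rhs m x * 2) / ((2 * x) * (2 * x))"
          unfolding d_Suc by (rule DERIV_imp_deriv)
        have rm: "rhs m x = 2 * x * d k x" using less.IH[of m] Suc x by simp
        have "2 * x * d (Suc k) x = E - 2 * d k x"
          unfolding eq rm using x0 by (simp add: field_simps)
        also have "\<dots> = rhs k x"
          unfolding E_def rhs_def Suc by (simp add: algebra_simps)
        finally show ?thesis using dk eq by simp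
      qed
    qed
  qed
  with assms show "(d k has_real_derivative d (Suc k) x) (at x)"
    and "2 * x * d (Suc k) x = (if k = 0 then -1 else 0) - x * leibniz_square d k x
       - real k * leibniz_square d (k - 1) x + 2 * (p - real k) * d k x"
    by (auto simp: rhs_def)
qed

lemma poly2_simps:
  "poly2 0 p y = 0" "poly2 1 p y = 1" "poly2 (R + S) p y = poly2 R p y + poly2 S p y" "poly2 (R - S) p y = poly2 R p y - poly2 S p y"
  "poly2 (- R) p y = - poly2 R p y" "poly2 (R * S) p y = poly2 R p y * poly2 S p y"
  "poly2 (of_nat n) p y = of_nat n" "poly2 (sum h A) p y = (\<Sum>i\<in>A. poly2 (h i) p y)"
  "poly2 (pCons a R) p y = poly a p + y * poly2 R p y"
  by (simp_all add: poly2_altdef poly_sum of_nat_poly mult.commute[of y])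

text \<open>A vanishes at y, which starts the recursion at 0. Multiplying by (2y)^k clears the
  denominators, since the power splits along the two factors of every Leibniz term.\<close>

lemma higher_deriv_quot_at_zero:
  assumes p: "p > -1" and y: "y \<in> bessel_Z p"
  shows "(deriv ^^ k) (bessel_quot p) y = poly2 (alpha_num k) p y / (2 * y) ^ k"
proof -
  have y0: "y > 0" "bessel_F p y = 0" using y by (auto simp: bessel_Z_def)
  then have yd: "y \<in> quot_domain p"
    using bessel_F_zeros_simple[OF p] by (simp add: quot_domain_def)
  define d where "d = (\<lambda>k. (deriv ^^ k) (bessel_quot p))"
  define e where "e = (\<lambda>k. poly2 (alpha_num k) p y)"
  have "(2 * y) ^ k * d k y = e k"
  proof (induction k rule: less_induct)
    case (less k)
    show ?case
    proof (cases k)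
      case 0
      then show ?thesis using y0 bessel_quot_eq[OF p, of y] by (simp add: d_def e_def poly2_simps)
    next
      case (Suc m)
      have Q: "(2 * y) ^ j * leibniz_square d j y = (\<Sum>i\<le>j. real (j choose i) * (e i * e (j - i)))" if "j \<le> m" for j
        unfolding leibniz_square_def sum_distrib_left
      proof (rule sum.cong[OF refl])
        fix i assume "i \<in> {..j}"
        then have "e i = (2 * y) ^ i * d i y" "e (j - i) = (2 * y) ^ (j - i) * d (j - i) y" 
          "(2 * y) ^ j = (2 * y) ^ i * (2 * y) ^ (j - i)"
          using less.IH[of i] less.IH[of "j - i"] that Suc power_add[of "2 * y" i "j - i"] by auto
        then show "(2 * y) ^ j * (real (j choose i) * (d i y * d (j - i) y)) = real (j choose i) * (e i * e (j - i))"
          by simp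
      qed
      have "(2 * y) ^ k * d k y = (2 * y) ^ m * (2 * y * d (Suc m) y)" by (simp add: Suc)
      also have "\<dots> = (2 * y) ^ m * ((if m = 0 then -1 else 0) - y * leibniz_square d m y
         - real m * leibniz_square d (m - 1) y + 2 * (p - real m) * d m y)"
        unfolding d_def higher_deriv_quot(2)[OF p yd] ..
      also have "\<dots> = (if m = 0 then -1 else 0) - y * ((2 * y) ^ m * leibniz_square d m y)
         - real m * ((2 * y) ^ m * leibniz_square d (m - 1) y) + 2 * (p - real m) * ((2 * y) ^ m * d m y)"
        by (simp add: algebra_simps)
      \<comment> \<open>One factor 2y is left over, as the square here has order m - 1; it is the
        source of the coefficient 2k y in \<open>alpha_num\<close>.\<close>
      also have "real m * ((2 * y) ^ m * leibniz_square d (m - 1) y) =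
          2 * real m * y * ((2 * y) ^ (m - 1) * leibniz_square d (m - 1) y)"
        by (cases m) auto
      also have "(2 * y) ^ m * d m y = e m" using less.IH[of m] Suc by simp
      finally have "(2 * y) ^ k * d k y = (if m = 0 then -1 else 0)
          - y * (\<Sum>i\<le>m. real (m choose i) * (e i * e (m - i)))
          - 2 * real m * y * (\<Sum>i\<le>m - 1. real ((m - 1) choose i) * (e i * e (m - 1 - i)))
          + 2 * (p - real m) * e m"
        unfolding Q[OF order_refl] Q[OF diff_le_self] .
      moreover have "e k = (if m = 0 then -1 else 0) + (2 * p - 2 * real m) * e m
          - y * (\<Sum>i\<le>m. real (m choose i) * (e i * e (m - i)))
          - y * (2 * real m) * (\<Sum>i\<le>m - 1. real ((m - 1) choose i) * (e i * e (m - 1 - i)))"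
        unfolding e_def Suc alpha_num.simps(2) poly2_simps by (simp add: poly2_simps)
      ultimately show ?thesis by (simp add: algebra_simps)
    qed
  qed
  then show ?thesis using y0 by (simp add: d_def e_def field_simps)
qed

section \<open>The sums over the zeros\<close>

text \<open>For t within d of x, the gap 2d gives both |a m - t| \<ge> |a m - x|/2 and |a m - t|
  \<ge> d. Two factors are compared with the convergent series of squares, the remaining ones with
  1/d, and the Weierstrass test permits termwise differentiation.\<close>

lemma reciprocal_power_series_deriv:
  fixes a :: "nat \<Rightarrow> real"
  assumes d: "d > 0" "\<And>m. \<bar>a m - x\<bar> > 2 * d" and j: "j \<ge> 2"
    and summ: "summable (\<lambda>m. 1 / (a m - x)\<^sup>2)"
  shows "summable (\<lambda>m. 1 / (a m - x) ^ j)"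
    and "((\<lambda>x. \<Sum>m. 1 / (a m - x) ^ j) has_real_derivative real j * (\<Sum>m. 1 / (a m - x) ^ Suc j)) (at x)"
proof -
  have bound: "\<bar>1 / (a m - t) ^ i\<bar> \<le> 1 / d ^ (i - 2) * (4 * (1 / (a m - x)\<^sup>2))"
    if i: "i \<ge> 2" and t: "t \<in> cball x d" for i m t
  proof -
    have "\<bar>a m - x\<bar> \<le> \<bar>a m - t\<bar> + d" using t by (auto simp: dist_real_def)
    moreover have "A / 2 \<le> B \<and> d \<le> B \<and> 0 < A" if "2 * d < A" "A \<le> B + d" for A B
      using that d(1) by linarith
    ultimately have h: "\<bar>a m - t\<bar> \<ge> \<bar>a m - x\<bar> / 2" "\<bar>a m - t\<bar> \<ge> d" "\<bar>a m - x\<bar> > 0"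
      using d(2)[of m] by blast+
    have "d ^ (i - 2) * (\<bar>a m - x\<bar> / 2)\<^sup>2 \<le> \<bar>a m - t\<bar> ^ (i - 2) * \<bar>a m - t\<bar>\<^sup>2"
      using h d by (intro mult_mono power_mono) auto
    also have "\<dots> = \<bar>a m - t\<bar> ^ i" unfolding power_add[symmetric] using i by (simp only: le_add_diff_inverse2)
    finally have "1 / \<bar>a m - t\<bar> ^ i \<le> 1 / (d ^ (i - 2) * (\<bar>a m - x\<bar> / 2)\<^sup>2)"
      using h d by (intro divide_left_mono mult_pos_pos) auto
    then show ?thesis by (simp add: power_abs power_divide)
  qed
  have M: "summable (\<lambda>m. 1 / d ^ (i - 2) * (4 * (1 / (a m - x)\<^sup>2)))" for i
    by (intro summable_mult summ)
  have x: "x \<in> cball x d" "x \<in> interior (cball x d)" using d by auto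
  show s: "summable (\<lambda>m. 1 / (a m - x) ^ j)"
    by (rule summable_comparison_test'[OF M[of j], of 0]) (use bound[OF j x(1)] in simp)
  have unif: "uniformly_convergent_on (cball x d) (\<lambda>n t. \<Sum>m<n. real j * (1 / (a m - t) ^ Suc j))"
  proof (rule Weierstrass_m_test')
    show "summable (\<lambda>m. real j * (1 / d ^ (Suc j - 2) * (4 * (1 / (a m - x)\<^sup>2))))"
      by (rule summable_mult[OF M])
    show "norm (real j * (1 / (a m - t) ^ Suc j)) \<le> real j * (1 / d ^ (Suc j - 2) * (4 * (1 / (a m - x)\<^sup>2)))"
      if "t \<in> cball x d" for m t
      unfolding real_norm_def abs_mult using bound[OF _ that, of "Suc j" m] j by (intro mult_mono) auto
  qed
  have der: "((\<lambda>t. 1 / (a m - t) ^ j) has_real_derivative real j * (1 / (a m - t) ^ Suc j)) (at t within cball x d)"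
    if t: "t \<in> cball x d" for m t
  proof -
    have "\<bar>a m - x\<bar> \<le> \<bar>a m - t\<bar> + d" using t by (auto simp: dist_real_def)
    with d(2)[of m] d(1) have ne: "a m - t \<noteq> 0" by linarith
    obtain l where l: "j = Suc l" using j by (cases j) auto
    have "((\<lambda>t. 1 / (a m - t) ^ j) has_real_derivative
      (0 * (a m - t) ^ j - 1 * (real j * ((0 - 1) * (a m - t) ^ (j - Suc 0)))) / ((a m - t) ^ j * (a m - t) ^ j)) (at t within cball x d)"
      by (intro DERIV_divide DERIV_const DERIV_power DERIV_diff DERIV_ident) (use ne in auto)
    also have "(0 * (a m - t) ^ j - 1 * (real j * ((0 - 1) * (a m - t) ^ (j - Suc 0)))) / ((a m - t) ^ j * (a m - t) ^ j)
       = real j * (1 / (a m - t) ^ Suc j)"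
      using ne unfolding l by simp
    finally show ?thesis .
  qed
  have "((\<lambda>x. \<Sum>m. 1 / (a m - x) ^ j) has_real_derivative (\<Sum>m. real j * (1 / (a m - x) ^ Suc j))) (at x)"
    using der unif s x by (intro has_field_derivative_series'(2)[of "cball x d"]) auto
  also have "(\<Sum>m. real j * (1 / (a m - x) ^ Suc j)) = real j * (\<Sum>m. 1 / (a m - x) ^ Suc j)"
  proof (rule suminf_mult)
    show "summable (\<lambda>m. 1 / (a m - x) ^ Suc j)"
      by (rule summable_comparison_test'[OF M[of "Suc j"], of 0]) (use bound[OF _ x(1), of "Suc j"] j in simp)
  qed
  finally show "((\<lambda>x. \<Sum>m. 1 / (a m - x) ^ j) has_real_derivative real j * (\<Sum>m. 1 / (a m - x) ^ Suc j)) (at x)" .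
qed

section \<open>Partial fractions along the enumerated zeros\<close>

definition bessel_sq :: "real \<Rightarrow> nat \<Rightarrow> real" where
  "bessel_sq \<nu> m = (bessel_zero \<nu> (Suc m))\<^sup>2"

lemma bessel_sq_sums:
  assumes p: "p > -1" and x: "x \<in> quot_domain p"
  shows "(\<lambda>m. 1 / (bessel_sq (p + 1) m - x)\<^sup>2) sums
     (((bessel_F (p + 2) x)\<^sup>2 - bessel_F (p + 1) x * bessel_F (p + 3) x) / (16 * (bessel_F (p + 1) x)\<^sup>2))"
proof -
  have \<nu>: "p + 1 > -1" using p by simp
  have "((\<lambda>a. 1 / (a - x)\<^sup>2) has_sum
     (((bessel_F (p + 2) x)\<^sup>2 - bessel_F (p + 1) x * bessel_F (p + 3) x) / (16 * (bessel_F (p + 1) x)\<^sup>2))) (bessel_Z (p + 1))"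
    using bessel_Z_has_sum[OF \<nu>, of x] x by (simp add: quot_domain_def add.assoc)
  then have "((\<lambda>m. 1 / (bessel_sq (p + 1) m - x)\<^sup>2) has_sum
     (((bessel_F (p + 2) x)\<^sup>2 - bessel_F (p + 1) x * bessel_F (p + 3) x) / (16 * (bessel_F (p + 1) x)\<^sup>2))) UNIV"
    using has_sum_reindex_bij_betw[OF bij_betw_bessel_zero(1)[OF \<nu>], of "\<lambda>a. 1 / (a - x)\<^sup>2"]
    by (simp add: bessel_sq_def)
  then show ?thesis by (rule has_sum_imp_sums)
qed

lemma bessel_sq_separated:
  assumes p: "p > -1" and x: "x \<in> quot_domain p"
  shows "\<exists>d>0. \<forall>m. \<bar>bessel_sq (p + 1) m - x\<bar> > 2 * d"
proof -
  obtain e where e: "e > 0" "cball x e \<subseteq> quot_domain p"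
    using open_contains_cball[of "quot_domain p"] open_quot_domain[OF p] x by blast
  have "\<bar>bessel_sq (p + 1) m - x\<bar> > e" for m
  proof -
    have "bessel_sq (p + 1) m \<in> bessel_Z (p + 1)"
      using bij_betw_bessel_zero(2)[of "p + 1" "Suc m"] p by (simp add: bessel_sq_def)
    then have "bessel_sq (p + 1) m \<notin> quot_domain p" by (simp add: bessel_Z_def quot_domain_def)
    then have "bessel_sq (p + 1) m \<notin> cball x e" using e by blast
    then show ?thesis by (simp add: dist_real_def abs_minus_commute)
  qed
  then show ?thesis using e by (intro exI[of _ "e / 2"]) auto
qed

text \<open>The first derivative of A is known as a series with exponent 2, so the induction starts
  at k = 1; each further derivative is termwise.\<close>

lemma higher_deriv_quot_series:
  assumes p: "p > -1" and "x \<in> quot_domain p" and "k \<ge> 1"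
  shows "summable (\<lambda>m. 1 / (bessel_sq (p + 1) m - x) ^ Suc k)"
    and "(deriv ^^ k) (bessel_quot p) x =
      2 * (p + 1) * (- 1) ^ k * fact k / x ^ Suc k - 2 * fact k * (\<Sum>m. 1 / (bessel_sq (p + 1) m - x) ^ Suc k)"
proof -
  define a where "a = bessel_sq (p + 1)"
  have s2: "summable (\<lambda>m. 1 / (a m - x)\<^sup>2)" if "x \<in> quot_domain p" for x
    using sums_summable[OF bessel_sq_sums[OF p that]] by (simp add: a_def)
  have deriv_a: "summable (\<lambda>m. 1 / (a m - x) ^ j)"
    "((\<lambda>x. \<Sum>m. 1 / (a m - x) ^ j) has_real_derivative real j * (\<Sum>m. 1 / (a m - x) ^ Suc j)) (at x)"
    if "x \<in> quot_domain p" "j \<ge> 2" for x j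
    using bessel_sq_separated[OF p that(1)] reciprocal_power_series_deriv[OF _ _ that(2) s2[OF that(1)]]
    unfolding a_def by blast+
  show "summable (\<lambda>m. 1 / (bessel_sq (p + 1) m - x) ^ Suc k)"
    using deriv_a(1)[OF assms(2), of "Suc k"] assms(3) by (simp add: a_def)
  have "\<forall>x\<in>quot_domain p. (deriv ^^ k) (bessel_quot p) x =
      2 * (p + 1) * (- 1) ^ k * fact k / x ^ Suc k - 2 * fact k * (\<Sum>m. 1 / (a m - x) ^ Suc k)"
    using \<open>k \<ge> 1\<close>
  proof (induction k rule: dec_induct)
    case base
    show ?case
    proof
      fix x assume x: "x \<in> quot_domain p"
      show "(deriv ^^ 1) (bessel_quot p) x = 2 * (p + 1) * (- 1) ^ 1 * fact 1 / x ^ Suc 1 - 2 * fact 1 * (\<Sum>m. 1 / (a m - x) ^ Suc 1)"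
      proof -
        define q where "q = ((bessel_F (p + 2) x)\<^sup>2 - bessel_F (p + 1) x * bessel_F (p + 3) x) / (16 * (bessel_F (p + 1) x)\<^sup>2)"
        have q: "(\<Sum>m. 1 / (a m - x) ^ Suc 1) = q"
          using sums_unique[OF bessel_sq_sums[OF p x]] by (simp add: q_def a_def power2_eq_square)
        have "(deriv ^^ 1) (bessel_quot p) x = - 2 * (p + 1) / x\<^sup>2 - 2 * q"
          using DERIV_imp_deriv[OF quot_deriv(2)[OF p x]] by (simp add: q_def)
        then show ?thesis unfolding q by (simp add: power2_eq_square)
      qed
    qed
  next
    case (step k)
    show ?case
    proof
      fix x assume x: "x \<in> quot_domain p"
      then have x0: "x > 0" by (simp add: quot_domain_def)
      define \<sigma> where "\<sigma> = (\<lambda>j x. \<Sum>m. 1 / (a m - x) ^ j)"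
      define K where "K = 2 * (p + 1) * (- 1) ^ k * fact k"
      have "((\<lambda>t. K / t ^ Suc k - 2 * fact k * \<sigma> (Suc k) t) has_real_derivative
         (0 * x ^ Suc k - K * (real (Suc k) * (1 * x ^ (Suc k - Suc 0)))) / (x ^ Suc k * x ^ Suc k)
         - 2 * fact k * (real (Suc k) * \<sigma> (Suc (Suc k)) x)) (at x)"
        unfolding \<sigma>_def using x0 step.hyps
        by (intro DERIV_diff DERIV_divide DERIV_const DERIV_power DERIV_ident DERIV_cmult deriv_a x) auto
      moreover have "eventually (\<lambda>t. (deriv ^^ k) (bessel_quot p) t = K / t ^ Suc k - 2 * fact k * \<sigma> (Suc k) t) (nhds x)"
        using eventually_nhds_in_open[OF open_quot_domain[OF p] x]
        by eventually_elim (use step.IH in \<open>simp add: K_def \<sigma>_def\<close>)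
      ultimately have "((deriv ^^ k) (bessel_quot p) has_real_derivative
         (0 * x ^ Suc k - K * (real (Suc k) * (1 * x ^ (Suc k - Suc 0)))) / (x ^ Suc k * x ^ Suc k)
         - 2 * fact k * (real (Suc k) * \<sigma> (Suc (Suc k)) x)) (at x)"
        by (rule DERIV_transform_nhds)
      then have "(deriv ^^ Suc k) (bessel_quot p) x =
         (0 * x ^ Suc k - K * (real (Suc k) * (1 * x ^ (Suc k - Suc 0)))) / (x ^ Suc k * x ^ Suc k)
         - 2 * fact k * (real (Suc k) * \<sigma> (Suc (Suc k)) x)"
        by (simp only: funpow.simps o_apply DERIV_imp_deriv)
      also have "(0 * x ^ Suc k - K * (real (Suc k) * (1 * x ^ (Suc k - Suc 0)))) / (x ^ Suc k * x ^ Suc k)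
          = - K * real (Suc k) / x ^ Suc (Suc k)"
        using x0 by (simp del: of_nat_Suc)
      also have "- K * real (Suc k) = 2 * (p + 1) * (- 1) ^ Suc k * fact (Suc k)"
        by (simp add: K_def del: of_nat_Suc)
      also have "2 * fact k * (real (Suc k) * \<sigma> (Suc (Suc k)) x) = 2 * fact (Suc k) * \<sigma> (Suc (Suc k)) x"
        by (simp del: of_nat_Suc)
      finally show "(deriv ^^ Suc k) (bessel_quot p) x =
         2 * (p + 1) * (- 1) ^ Suc k * fact (Suc k) / x ^ Suc (Suc k) - 2 * fact (Suc k) * (\<Sum>m. 1 / (a m - x) ^ Suc (Suc k))"
        by (simp add: \<sigma>_def)
    qed
  qed
  with assms(2) show "(deriv ^^ k) (bessel_quot p) x =
      2 * (p + 1) * (- 1) ^ k * fact k / x ^ Suc k - 2 * fact k * (\<Sum>m. 1 / (bessel_sq (p + 1) m - x) ^ Suc k)"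
    by (simp add: a_def)
qed

text \<open>Writing a y = y(a - y) + y^2 splits the sum into exponents r - 1 and r, that is, into
  derivatives of A of orders r - 2 and r - 1, both at least 1.\<close>

lemma bessel_sum_eq:
  assumes p: "p > -1" and n: "n \<ge> 1" and r: "r \<ge> 3"
  defines "y \<equiv> (bessel_zero p n)\<^sup>2"
  shows "summable (\<lambda>m. bessel_sum_term r p n (Suc m))"
    and "bessel_sum r p n = - (y / 2) * (bessel_alpha (r - 2) p n + y * bessel_alpha (r - 1) p n)"
proof -
  have y: "y \<in> bessel_Z p" using bij_betw_bessel_zero(2)[OF p n] by (simp add: y_def)
  then have y0: "y > 0" and yd: "y \<in> quot_domain p"
    using bessel_F_zeros_simple[OF p] by (auto simp: bessel_Z_def quot_domain_def)
  obtain k where k: "r = Suc (Suc k)" "k \<ge> 1" using r by (cases r; cases "r - 1") auto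
  define a where "a = bessel_sq (p + 1)"
  define \<sigma> where "\<sigma> = (\<lambda>j. \<Sum>m. 1 / (a m - y) ^ j)"
  have s: "summable (\<lambda>m. 1 / (a m - y) ^ Suc k)" "summable (\<lambda>m. 1 / (a m - y) ^ Suc (Suc k))"
    using higher_deriv_quot_series(1)[OF p yd, of k] higher_deriv_quot_series(1)[OF p yd, of "Suc k"] k
    by (simp_all add: a_def)
  obtain d where d: "d > 0" "\<And>m. \<bar>a m - y\<bar> > 2 * d" using bessel_sq_separated[OF p yd] unfolding a_def by blast
  have ne: "a m - y \<noteq> 0" for m using d(1) d(2)[of m] by auto
  have trm: "bessel_sum_term r p n (Suc m) = y * (1 / (a m - y) ^ Suc k) + y\<^sup>2 * (1 / (a m - y) ^ Suc (Suc k))" for m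
  proof -
    have "bessel_sum_term r p n (Suc m) = (y * (a m - y) + y\<^sup>2) / (a m - y) ^ Suc (Suc k)"
      unfolding bessel_sum_term_def k a_def y_def bessel_sq_def by (simp add: algebra_simps power2_eq_square)
    also have "\<dots> = y * (1 / (a m - y) ^ Suc k) + y\<^sup>2 * (1 / (a m - y) ^ Suc (Suc k))"
      using ne[of m] by (simp add: add_divide_distrib)
    finally show ?thesis .
  qed
  have sums: "(\<lambda>m. bessel_sum_term r p n (Suc m)) sums (y * \<sigma> (Suc k) + y\<^sup>2 * \<sigma> (Suc (Suc k)))"
    unfolding trm \<sigma>_def using s by (intro sums_add sums_mult summable_sums)
  then show "summable (\<lambda>m. bessel_sum_term r p n (Suc m))" by (rule sums_summable)
  have al: "bessel_alpha j p n = 2 * (p + 1) * (- 1) ^ j / y ^ Suc j - 2 * \<sigma> (Suc j)" if "j \<ge> 1" for j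
    unfolding bessel_alpha_def y_def[symmetric] higher_deriv_quot_series(2)[OF p yd that] \<sigma>_def a_def
    by (simp add: diff_divide_distrib)
  have "bessel_sum r p n = y * \<sigma> (Suc k) + y\<^sup>2 * \<sigma> (Suc (Suc k))"
    unfolding bessel_sum_def using sums by (rule sums_unique[symmetric])
  also have "\<dots> = - (y / 2) * (bessel_alpha k p n + y * bessel_alpha (Suc k) p n)"
  proof -
    define c where "c = (\<lambda>j. 2 * (p + 1) * (- 1) ^ j / y ^ Suc j)"
    \<comment> \<open>The pole contributions: the next one changes sign and gains a factor 1/y, so
      this combination cancels them.\<close>
    have c: "c k + y * c (Suc k) = 0" using y0 by (simp add: c_def)
    have "bessel_alpha k p n + y * bessel_alpha (Suc k) p n = (c k - 2 * \<sigma> (Suc k)) + y * (c (Suc k) - 2 * \<sigma> (Suc (Suc k)))"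
      using al k(2) by (simp add: c_def)
    also have "\<dots> = (c k + y * c (Suc k)) - 2 * (\<sigma> (Suc k) + y * \<sigma> (Suc (Suc k)))"
      by (simp add: algebra_simps)
    finally have eq: "bessel_alpha k p n + y * bessel_alpha (Suc k) p n = - 2 * (\<sigma> (Suc k) + y * \<sigma> (Suc (Suc k)))"
      unfolding c by simp
    show ?thesis unfolding eq by (simp add: algebra_simps power2_eq_square)
  qed
  finally show "bessel_sum r p n = - (y / 2) * (bessel_alpha (r - 2) p n + y * bessel_alpha (r - 1) p n)"
    by (simp add: k)
qed

theorem theorem1:
  shows "(\<forall>k::nat. k \<ge> 1 \<longrightarrow>
           (\<exists>R :: real poly poly.
              R \<noteq> 0 \<and> degree R = (k - 1) div 2 \<and>
              (\<forall>(p::real) (n::nat). p > -1 \<longrightarrow> n \<ge> 1 \<longrightarrow>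
                 bessel_alpha k p n =
                   poly2 R p ((bessel_zero p n)\<^sup>2) / (2 ^ k * fact k * ((bessel_zero p n)\<^sup>2) ^ k))))
       \<and> (\<forall>r::nat. r \<ge> 3 \<longrightarrow>
           (\<exists>P :: real poly poly.
              P \<noteq> 0 \<and> degree P = (r - 2) div 2 \<and>
              degree (pcompose P [:0, 0, 1:]) = 2 * ((r - 2) div 2) \<and>
              degree (pcompose P [:0, 0, 1:]) = (if even r then r - 2 else r - 3) \<and>
              (\<forall>(p::real) (n::nat). p > -1 \<longrightarrow> n \<ge> 1 \<longrightarrow>
                 summable (\<lambda>m. bessel_sum_term r p n (Suc m)) \<and>
                 bessel_sum r p n =
                   poly2 P p ((bessel_zero p n)\<^sup>2) /
                     (2 ^ r * fact (r - 1) * ((bessel_zero p n)\<^sup>2) ^ (r - 3)))))"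
proof -
  have alpha: "bessel_alpha k p n =
      poly2 (alpha_num k) p ((bessel_zero p n)\<^sup>2) / (2 ^ k * fact k * ((bessel_zero p n)\<^sup>2) ^ k)"
    if "p > -1" "n \<ge> 1" for k p n
    using higher_deriv_quot_at_zero[OF that(1), of "(bessel_zero p n)\<^sup>2" k] bij_betw_bessel_zero(2)[OF that]
    by (simp add: bessel_alpha_def power_mult_distrib mult_ac)
  \<comment> \<open>In degree 0 the degree alone does not exclude the zero polynomial, so a nonzero
    coefficient is demanded.\<close>
  have deg: "R \<noteq> 0 \<and> degree R = d" if "degree R \<le> d" "coeff R d \<noteq> 0" for R :: "real poly poly" and d
    using that le_degree[of R d] by auto
  show ?thesis
  proof (intro conjI allI impI)
    fix k :: nat assume "k \<ge> 1"
    with alpha_num_degree_sign[of k] deg[of "alpha_num k"] alpha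
    show "\<exists>R :: real poly poly.
              R \<noteq> 0 \<and> degree R = (k - 1) div 2 \<and>
              (\<forall>(p::real) (n::nat). p > -1 \<longrightarrow> n \<ge> 1 \<longrightarrow>
                 bessel_alpha k p n =
                   poly2 R p ((bessel_zero p n)\<^sup>2) / (2 ^ k * fact k * ((bessel_zero p n)\<^sup>2) ^ k))"
      by (intro exI[of _ "alpha_num k"]) auto
  next
    fix r :: nat assume "r \<ge> 3"
    then obtain k where k: "r = Suc (Suc k)" "k \<ge> 1" by (cases r; cases "r - 1") auto
    \<comment> \<open>Over a common denominator, alpha_k + y alpha_{k+1} has the numerator 2(k + 1)
      R_k + R_{k+1}; the sign comes from the factor -y/2.\<close>
    define P where "P = - (of_nat (2 * Suc k) * alpha_num k + alpha_num (Suc k))"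
    define D where "D = k div 2"
    \<comment> \<open>For even k the degree of \<open>alpha_num k\<close> is only D - 1 and its
      coefficient at D is zero; for odd k it is negative like that of
      \<open>alpha_num (Suc k)\<close>. In neither case can the leading terms cancel.\<close>
    have Rk: "degree (alpha_num k) \<le> D" "coeff (alpha_num k) D \<le> 0"
    proof -
      have "(k - 1) div 2 \<le> D" by (simp add: D_def div_le_mono)
      with alpha_num_degree_sign[OF k(2)] show "degree (alpha_num k) \<le> D" "coeff (alpha_num k) D \<le> 0"
        by (cases "D = (k - 1) div 2"; force simp: coeff_eq_0)+
    qed
    have RS: "degree (alpha_num (Suc k)) \<le> D" "coeff (alpha_num (Suc k)) D < 0"
      using alpha_num_degree_sign[of "Suc k"] by (auto simp: D_def)
    have cP: "coeff P j = - (of_nat (2 * Suc k) * coeff (alpha_num k) j + coeff (alpha_num (Suc k)) j)" for j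
      by (simp add: P_def of_nat_poly)
    have "degree P \<le> D"
      using Rk(1) RS(1) by (intro degree_le allI impI) (simp add: cP coeff_eq_0)
    moreover have "coeff P D > 0"
    proof -
      have "of_nat (2 * Suc k) * coeff (alpha_num k) D \<le> 0"
        using Rk(2) by (intro mult_nonneg_nonpos) auto
      with RS(2) show ?thesis unfolding cP by (simp only: neg_0_less_iff_less add_nonpos_neg)
    qed
    ultimately have P: "P \<noteq> 0 \<and> degree P = D" by (intro deg) auto
    have dc: "degree (pcompose P [:0, 0, 1:]) = 2 * D"
      using P by (simp add: degree_pcompose)
    have sum: "summable (\<lambda>m. bessel_sum_term r p n (Suc m)) \<and>
        bessel_sum r p n = poly2 P p ((bessel_zero p n)\<^sup>2) / (2 ^ r * fact (r - 1) * ((bessel_zero p n)\<^sup>2) ^ (r - 3))"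
      if pn: "p > -1" "n \<ge> 1" for p n
    proof
      show "summable (\<lambda>m. bessel_sum_term r p n (Suc m))" by (rule bessel_sum_eq(1)[OF pn \<open>r \<ge> 3\<close>])
      define y where "y = (bessel_zero p n)\<^sup>2"
      have y0: "y > 0" using bij_betw_bessel_zero(2)[OF pn] by (simp add: y_def bessel_Z_def)
      define u v where "u = poly2 (alpha_num k) p y" and "v = poly2 (alpha_num (Suc k)) p y"
      \<comment> \<open>Writing y^(r - 3) as y^l avoids truncated subtraction; the factor y of -y/2
        lowers the exponent from k to l.\<close>
      obtain l where l: "k = Suc l" using k by (cases k) auto
      have "bessel_sum r p n = - (y / 2) * (u / (2 ^ k * fact k * y ^ k) + y * (v / (2 ^ Suc k * fact (Suc k) * y ^ Suc k)))"
        using bessel_sum_eq(2)[OF pn \<open>r \<ge> 3\<close>] alpha[OF pn, of k] alpha[OF pn, of "Suc k"]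
        by (simp add: k y_def u_def v_def)
      also have "\<dots> = - (2 * real (Suc k) * u + v) / (2 ^ r * fact (r - 1) * y ^ (r - 3))"
      proof -
        define q :: real where "q = 2 ^ k * fact k * y ^ l"
        have q: "q > 0" using y0 by (simp add: q_def)
        have eqs: "2 ^ k * fact k * y ^ k = q * y" "2 ^ Suc k * fact (Suc k) * y ^ Suc k = q * (2 * real (Suc k)) * (y * y)"
          "2 ^ r * fact (r - 1) * y ^ (r - 3) = q * (4 * real (Suc k))"
          by (simp_all add: q_def l k)
        have "real (Suc k) > 0" by simp
        then show ?thesis unfolding eqs using q y0 by (simp add: field_simps del: of_nat_Suc)
      qed
      also have "- (2 * real (Suc k) * u + v) = poly2 P p y"
        unfolding P_def poly2_simps u_def v_def by simp
      finally show "bessel_sum r p n = poly2 P p ((bessel_zero p n)\<^sup>2) / (2 ^ r * fact (r - 1) * ((bessel_zero p n)\<^sup>2) ^ (r - 3))"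
        by (simp add: y_def)
    qed
    show "\<exists>P :: real poly poly.
              P \<noteq> 0 \<and> degree P = (r - 2) div 2 \<and>
              degree (pcompose P [:0, 0, 1:]) = 2 * ((r - 2) div 2) \<and>
              degree (pcompose P [:0, 0, 1:]) = (if even r then r - 2 else r - 3) \<and>
              (\<forall>(p::real) (n::nat). p > -1 \<longrightarrow> n \<ge> 1 \<longrightarrow>
                 summable (\<lambda>m. bessel_sum_term r p n (Suc m)) \<and>
                 bessel_sum r p n =
                   poly2 P p ((bessel_zero p n)\<^sup>2) /
                     (2 ^ r * fact (r - 1) * ((bessel_zero p n)\<^sup>2) ^ (r - 3)))"
    proof (intro exI[of _ P] conjI allI impI)
      show "degree (pcompose P [:0, 0, 1:]) = (if even r then r - 2 else r - 3)"
        unfolding dc D_def k by (auto elim!: evenE oddE)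
    qed (use P dc sum in \<open>simp_all add: D_def k\<close>)
  qed
qed

end
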